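(* Let $\Lambda$ be an Artin algebra and $\mathcal X$ a resolving and contravariantly finite subcategory of $\mathrm{mod}\text{-}\Lambda$. Let $(X_1\xrightarrow{f}X_2)$ be an object of $\mathcal S^{\rm cw}_{\mathcal X}(\Lambda)$. Then it is an indecomposable projective object of the exact category $\mathcal S^{\rm cw}_{\mathcal X}(\Lambda)$ if and only if it is isomorphic to one of the following objects: (1) $(X\xrightarrow{1}X)$ for some indecomposable object $X$ in $\mathcal X$; (2) $(0\to X)$ for some indecomposable object $X$ in $\mathcal X$. Moreover, $\mathcal S^{\rm cw}_{\mathcal X}(\Lambda)$ has enough projectives.
   Context: $\Lambda$ is an Artin algebra over a commutative artinian ring; $\mathrm{mod}\text{-}\Lambda$ is the category of finitely generated right $\Lambda$-modules and $\mathrm{prj}\text{-}\Lambda$ its subcategory of projectives. Subcategories are full and closed under isomorphism. $\mathcal X$ is resolving if it contains $\mathrm{prj}\text{-}\Lambda$ and is closed under finite direct sums, direct summands, extensions and kernels of epimorphisms; it is contravariantly finite if every module $M$ admits a morphism $f:X\to M$ with $X\in\mathcal X$ through which every morphism from an object of $\mathcal X$ to $M$ factors. $\mathrm H(\Lambda)$ is the (abelian) morphism category of $\mathrm{mod}\text{-}\Lambda$: objects are morphisms $(A\xrightarrow{f}B)$, morphisms are commutative squares. $\mathcal S_{\mathcal X}(\Lambda)$ is the full subcategory of $\mathrm H(\Lambda)$ of all monomorphisms $(A\xrightarrow{f}B)$ with $A,B,\mathrm{Cok}\,f\in\mathcal X$. $\mathcal S^{\rm cw}_{\mathcal X}(\Lambda)$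 is the additive category $\mathcal S_{\mathcal X}(\Lambda)$ with the exact structure $\mathcal E^{\rm cw}_{\mathcal X}$ of all short exact sequences $0\to(X_1\to X_2)\to(Z_1\to Z_2)\to(Y_1\to Y_2)\to0$ of $\mathrm H(\Lambda)$ with terms in $\mathcal S_{\mathcal X}(\Lambda)$ such that both $0\to X_i\to Z_i\to Y_i\to0$, $i=1,2$, are split. Projectivity and enough projectives are relative to this exact structure. *)

theory Defs
  imports "HOL-Algebra.Module" "HOL-Algebra.Ideal"
begin

section \<open>Preadditive categories\<close>

datatype ('o, 'f) arrow = Arrow (src: 'o) (trg: 'o) (und: 'f)

record ('o, 'f) precat =
  Obj :: "'o set"
  Arr :: "('o, 'f) arrow set"
  Comp :: "('o, 'f) arrow \<Rightarrow> ('o, 'f) arrow \<Rightarrow> ('o, 'f) arrow"  (infixl "\<cdot>\<index>" 70)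
  Ident :: "'o \<Rightarrow> ('o, 'f) arrow"
  Plus :: "('o, 'f) arrow \<Rightarrow> ('o, 'f) arrow \<Rightarrow> ('o, 'f) arrow"  (infixl "\<boxplus>\<index>" 65)
  Null :: "'o \<Rightarrow> 'o \<Rightarrow> ('o, 'f) arrow"

definition Hom :: "('o, 'f) precat \<Rightarrow> 'o \<Rightarrow> 'o \<Rightarrow> ('o, 'f) arrow set" where
  "Hom C A B = {f \<in> Arr C. src f = A \<and> trg f = B}"

locale preadditive_category =
  fixes C :: "('o, 'f) precat" (structure)
  assumes arr_ends: "f \<in> Arr C \<Longrightarrow> src f \<in> Obj C \<and> trg f \<in> Obj C"
    and id_hom: "A \<in> Obj C \<Longrightarrow> Ident C A \<in> Hom C A A"
    and comp_hom: "\<lbrakk>f \<in> Hom C A B; g \<in> Hom C B D\<rbrakk> \<Longrightarrow> g \<cdot> f \<in> Hom C A D"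
    and comp_id: "f \<in> Hom C A B \<Longrightarrow> f \<cdot> Ident C A = f"
    and id_comp: "f \<in> Hom C A B \<Longrightarrow> Ident C B \<cdot> f = f"
    and comp_assoc: "\<lbrakk>f \<in> Hom C A B; g \<in> Hom C B D; h \<in> Hom C D E\<rbrakk>
      \<Longrightarrow> h \<cdot> g \<cdot> f = h \<cdot> (g \<cdot> f)"
    and null_hom: "\<lbrakk>A \<in> Obj C; B \<in> Obj C\<rbrakk> \<Longrightarrow> Null C A B \<in> Hom C A B"
    and plus_hom: "\<lbrakk>f \<in> Hom C A B; g \<in> Hom C A B\<rbrakk> \<Longrightarrow> f \<boxplus> g \<in> Hom C A B"
    and plus_assoc: "\<lbrakk>f \<in> Hom C A B; g \<in> Hom C A B; h \<in> Hom C A B\<rbrakk>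
      \<Longrightarrow> f \<boxplus> g \<boxplus> h = f \<boxplus> (g \<boxplus> h)"
    and plus_comm: "\<lbrakk>f \<in> Hom C A B; g \<in> Hom C A B\<rbrakk> \<Longrightarrow> f \<boxplus> g = g \<boxplus> f"
    and plus_null: "f \<in> Hom C A B \<Longrightarrow> f \<boxplus> Null C A B = f"
    and plus_inv: "f \<in> Hom C A B \<Longrightarrow> \<exists>g\<in>Hom C A B. f \<boxplus> g = Null C A B"
    and comp_plus: "\<lbrakk>f \<in> Hom C A B; g \<in> Hom C A B; h \<in> Hom C B D\<rbrakk>
      \<Longrightarrow> h \<cdot> (f \<boxplus> g) = h \<cdot> f \<boxplus> h \<cdot> g"
    and plus_comp: "\<lbrakk>f \<in> Hom C B D; g \<in> Hom C B D; h \<in> Hom C A B\<rbrakk>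
      \<Longrightarrow> (f \<boxplus> g) \<cdot> h = f \<cdot> h \<boxplus> g \<cdot> h"

definition full_subcat :: "('o, 'f) precat \<Rightarrow> 'o set \<Rightarrow> ('o, 'f) precat" where
  "full_subcat C S = C\<lparr>Obj := S, Arr := {f \<in> Arr C. src f \<in> S \<and> trg f \<in> S}\<rparr>"

lemma (in preadditive_category) full_subcat_preadditive:
  assumes "S \<subseteq> Obj C"
  shows "preadditive_category (full_subcat C S)"
proof -
  have hom: "Hom (full_subcat C S) A B = (if A \<in> S \<and> B \<in> S then Hom C A B else {})" for A B
    by (auto simp: full_subcat_def Hom_def)
  have sub: "A \<in> Obj C" if "A \<in> S" for A using assms that by blast
  have eqs: "Obj (full_subcat C S) = S" "Comp (full_subcat C S) = Comp C"
    "Ident (full_subcat C S) = Ident C" "Plus (full_subcat C S) = Plus C"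
    "Null (full_subcat C S) = Null C"
    by (simp_all add: full_subcat_def)
  show ?thesis
    by (unfold_locales; (unfold hom eqs)?)
      (auto split: if_splits intro: id_hom comp_hom comp_id id_comp comp_assoc null_hom plus_hom
        plus_assoc plus_comm plus_null plus_inv comp_plus plus_comp sub simp: full_subcat_def)
qed

definition isomorphic :: "('o, 'f) precat \<Rightarrow> 'o \<Rightarrow> 'o \<Rightarrow> bool" where
  "isomorphic C A B \<longleftrightarrow> A \<in> Obj C \<and> B \<in> Obj C \<and>
    (\<exists>f\<in>Hom C A B. \<exists>g\<in>Hom C B A. g \<cdot>\<^bsub>C\<^esub> f = Ident C A \<and> f \<cdot>\<^bsub>C\<^esub> g = Ident C B)"

definition is_mono :: "('o, 'f) precat \<Rightarrow> ('o, 'f) arrow \<Rightarrow> bool" where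
  "is_mono C f \<longleftrightarrow> f \<in> Arr C \<and>
    (\<forall>W\<in>Obj C. \<forall>g\<in>Hom C W (src f). \<forall>h\<in>Hom C W (src f). f \<cdot>\<^bsub>C\<^esub> g = f \<cdot>\<^bsub>C\<^esub> h \<longrightarrow> g = h)"

definition is_epi :: "('o, 'f) precat \<Rightarrow> ('o, 'f) arrow \<Rightarrow> bool" where
  "is_epi C f \<longleftrightarrow> f \<in> Arr C \<and>
    (\<forall>W\<in>Obj C. \<forall>g\<in>Hom C (trg f) W. \<forall>h\<in>Hom C (trg f) W. g \<cdot>\<^bsub>C\<^esub> f = h \<cdot>\<^bsub>C\<^esub> f \<longrightarrow> g = h)"

definition is_zero :: "('o, 'f) precat \<Rightarrow> 'o \<Rightarrow> bool" where
  "is_zero C Z \<longleftrightarrow> Z \<in> Obj C \<and> Ident C Z = Null C Z Z"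

definition is_kernel :: "('o, 'f) precat \<Rightarrow> ('o, 'f) arrow \<Rightarrow> ('o, 'f) arrow \<Rightarrow> bool" where
  "is_kernel C k f \<longleftrightarrow> k \<in> Arr C \<and> f \<in> Arr C \<and> trg k = src f \<and>
    f \<cdot>\<^bsub>C\<^esub> k = Null C (src k) (trg f) \<and>
    (\<forall>W\<in>Obj C. \<forall>g\<in>Hom C W (src f). f \<cdot>\<^bsub>C\<^esub> g = Null C W (trg f) \<longrightarrow>
      (\<exists>!h. h \<in> Hom C W (src k) \<and> k \<cdot>\<^bsub>C\<^esub> h = g))"

definition is_cokernel :: "('o, 'f) precat \<Rightarrow> ('o, 'f) arrow \<Rightarrow> ('o, 'f) arrow \<Rightarrow> bool" where
  "is_cokernel C c f \<longleftrightarrow> c \<in> Arr C \<and> f \<in> Arr C \<and> src c = trg f \<and>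
    c \<cdot>\<^bsub>C\<^esub> f = Null C (src f) (trg c) \<and>
    (\<forall>W\<in>Obj C. \<forall>g\<in>Hom C (trg f) W. g \<cdot>\<^bsub>C\<^esub> f = Null C (src f) W \<longrightarrow>
      (\<exists>!h. h \<in> Hom C (trg c) W \<and> h \<cdot>\<^bsub>C\<^esub> c = g))"

definition short_exact :: "('o, 'f) precat \<Rightarrow> ('o, 'f) arrow \<Rightarrow> ('o, 'f) arrow \<Rightarrow> bool" where
  "short_exact C i p \<longleftrightarrow> is_kernel C i p \<and> is_cokernel C p i"

definition split_exact :: "('o, 'f) precat \<Rightarrow> ('o, 'f) arrow \<Rightarrow> ('o, 'f) arrow \<Rightarrow> bool" where
  "split_exact C i p \<longleftrightarrow> short_exact C i p \<and>
    (\<exists>s\<in>Hom C (trg p) (src p). p \<cdot>\<^bsub>C\<^esub> s = Ident C (trg p))"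

definition is_biproduct :: "('o, 'f) precat \<Rightarrow> 'o \<Rightarrow> 'o \<Rightarrow> 'o \<Rightarrow> bool" where
  "is_biproduct C S A B \<longleftrightarrow> S \<in> Obj C \<and> A \<in> Obj C \<and> B \<in> Obj C \<and>
    (\<exists>i\<in>Hom C A S. \<exists>j\<in>Hom C B S. \<exists>p\<in>Hom C S A. \<exists>q\<in>Hom C S B.
      p \<cdot>\<^bsub>C\<^esub> i = Ident C A \<and> q \<cdot>\<^bsub>C\<^esub> j = Ident C B \<and>
      p \<cdot>\<^bsub>C\<^esub> j = Null C B A \<and> q \<cdot>\<^bsub>C\<^esub> i = Null C A B \<and>
      i \<cdot>\<^bsub>C\<^esub> p \<boxplus>\<^bsub>C\<^esub> j \<cdot>\<^bsub>C\<^esub> q = Ident C S)"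

definition indecomposable :: "('o, 'f) precat \<Rightarrow> 'o \<Rightarrow> bool" where
  "indecomposable C M \<longleftrightarrow> M \<in> Obj C \<and> \<not> is_zero C M \<and>
    (\<forall>A B. is_biproduct C M A B \<longrightarrow> is_zero C A \<or> is_zero C B)"

definition projective_wrt ::
    "('o, 'f) precat \<Rightarrow> ('o, 'f) arrow set \<Rightarrow> 'o \<Rightarrow> bool" where
  "projective_wrt C D P \<longleftrightarrow> P \<in> Obj C \<and>
    (\<forall>p\<in>D. \<forall>f\<in>Hom C P (trg p). \<exists>g\<in>Hom C P (src p). p \<cdot>\<^bsub>C\<^esub> g = f)"

text \<open>An exact structure is given as a set \<open>E\<close> of conflations \<open>(i, p)\<close>; the deflations are
  the second components.\<close>

definition exact_projective ::
    "('o, 'f) precat \<Rightarrow> (('o, 'f) arrow \<times> ('o, 'f) arrow) set \<Rightarrow> 'o \<Rightarrow> bool" where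
  "exact_projective C E P \<longleftrightarrow> projective_wrt C (snd ` E) P"

definition enough_projectives ::
    "('o, 'f) precat \<Rightarrow> (('o, 'f) arrow \<times> ('o, 'f) arrow) set \<Rightarrow> bool" where
  "enough_projectives C E \<longleftrightarrow>
    (\<forall>Y\<in>Obj C. \<exists>(i, p)\<in>E. trg p = Y \<and> exact_projective C E (src p))"


section \<open>Resolving and contravariantly finite subcategories\<close>

text \<open>A full subcategory closed under isomorphism is represented by its class of objects.\<close>

definition iso_closed_subcat :: "('o, 'f) precat \<Rightarrow> 'o set \<Rightarrow> bool" where
  "iso_closed_subcat C \<X> \<longleftrightarrow> \<X> \<subseteq> Obj C \<and> (\<forall>A\<in>\<X>. \<forall>B. isomorphic C A B \<longrightarrow> B \<in> \<X>)"

text \<open>The empty direct sum, a zero object, is projective, so closure under binary direct sums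
  suffices.\<close>

definition resolving :: "('o, 'f) precat \<Rightarrow> 'o set \<Rightarrow> bool" where
  "resolving C \<X> \<longleftrightarrow> iso_closed_subcat C \<X> \<and>
    {P. projective_wrt C {p. is_epi C p} P} \<subseteq> \<X> \<and>
    (\<forall>S A B. is_biproduct C S A B \<longrightarrow> A \<in> \<X> \<longrightarrow> B \<in> \<X> \<longrightarrow> S \<in> \<X>) \<and>
    (\<forall>S A B. is_biproduct C S A B \<longrightarrow> S \<in> \<X> \<longrightarrow> A \<in> \<X> \<and> B \<in> \<X>) \<and>
    (\<forall>i p. short_exact C i p \<longrightarrow> src i \<in> \<X> \<longrightarrow> trg p \<in> \<X> \<longrightarrow> src p \<in> \<X>) \<and>
    (\<forall>k p. is_epi C p \<longrightarrow> is_kernel C k p \<longrightarrow> src p \<in> \<X> \<longrightarrow> trg p \<in> \<X> \<longrightarrow> src k \<in> \<X>)"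

definition contravariantly_finite :: "('o, 'f) precat \<Rightarrow> 'o set \<Rightarrow> bool" where
  "contravariantly_finite C \<X> \<longleftrightarrow>
    (\<forall>M\<in>Obj C. \<exists>X\<in>\<X>. \<exists>f\<in>Hom C X M.
      \<forall>X'\<in>\<X>. \<forall>g\<in>Hom C X' M. \<exists>h\<in>Hom C X' X. f \<cdot>\<^bsub>C\<^esub> h = g)"


section \<open>The morphism category and the category \<open>S\<^sub>X\<close>\<close>

text \<open>An object is an arrow of \<open>C\<close>, a morphism from \<open>f\<close> to \<open>g\<close> a pair \<open>(a, b)\<close> with
  \<open>b \<cdot> f = g \<cdot> a\<close>.\<close>

definition mor_cat ::
    "('o, 'f) precat \<Rightarrow> (('o, 'f) arrow, ('o, 'f) arrow \<times> ('o, 'f) arrow) precat" where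
  "mor_cat C = \<lparr>
    Obj = Arr C,
    Arr = {Arrow f g (a, b) | f g a b.
      f \<in> Arr C \<and> g \<in> Arr C \<and> a \<in> Hom C (src f) (src g) \<and> b \<in> Hom C (trg f) (trg g) \<and>
      b \<cdot>\<^bsub>C\<^esub> f = g \<cdot>\<^bsub>C\<^esub> a},
    Comp = (\<lambda>v u. Arrow (src u) (trg v)
      (fst (und v) \<cdot>\<^bsub>C\<^esub> fst (und u), snd (und v) \<cdot>\<^bsub>C\<^esub> snd (und u))),
    Ident = (\<lambda>f. Arrow f f (Ident C (src f), Ident C (trg f))),
    Plus = (\<lambda>u v. Arrow (src u) (trg u)
      (fst (und u) \<boxplus>\<^bsub>C\<^esub> fst (und v), snd (und u) \<boxplus>\<^bsub>C\<^esub> snd (und v))),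
    Null = (\<lambda>f g. Arrow f g (Null C (src f) (src g), Null C (trg f) (trg g)))\<rparr>"

lemma mem_Hom_mor_cat:
  "u \<in> Hom (mor_cat C) f g \<longleftrightarrow> f \<in> Arr C \<and> g \<in> Arr C \<and>
    (\<exists>a b. u = Arrow f g (a, b) \<and> a \<in> Hom C (src f) (src g) \<and> b \<in> Hom C (trg f) (trg g) \<and>
      b \<cdot>\<^bsub>C\<^esub> f = g \<cdot>\<^bsub>C\<^esub> a)"
  by (auto simp: Hom_def mor_cat_def)

lemma (in preadditive_category) mor_cat_preadditive: "preadditive_category (mor_cat C)"
proof -
  have arr: "f \<in> Hom C (src f) (trg f)" "src f \<in> Obj C" "trg f \<in> Obj C" if "f \<in> Arr C" for f
    using that arr_ends by (auto simp: Hom_def)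
  have null_comp: "Null C B D \<cdot> f = Null C A D" if "f \<in> Hom C A B" "D \<in> Obj C" for f A B D
  proof -
    let ?z = "Null C B D \<cdot> f"
    have B: "A \<in> Obj C" "B \<in> Obj C" using that arr_ends by (auto simp: Hom_def)
    have n: "Null C B D \<in> Hom C B D" using B that null_hom by blast
    have z: "?z \<in> Hom C A D" using that n comp_hom by blast
    have dbl: "?z \<boxplus> ?z = ?z" using plus_comp[OF n n that(1)] plus_null[OF n] by simp
    obtain w where w: "w \<in> Hom C A D" "?z \<boxplus> w = Null C A D" using plus_inv[OF z] by blast
    have "?z = ?z \<boxplus> (?z \<boxplus> w)" using w z plus_null by simp
    also have "\<dots> = Null C A D" using plus_assoc[OF z z w(1)] dbl w by simp
    finally show ?thesis .
  qed
  have comp_null: "f \<cdot> Null C A B = Null C A D" if "f \<in> Hom C B D" "A \<in> Obj C" for f A B D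
  proof -
    let ?z = "f \<cdot> Null C A B"
    have B: "B \<in> Obj C" "D \<in> Obj C" using that arr_ends by (auto simp: Hom_def)
    have n: "Null C A B \<in> Hom C A B" using B that null_hom by blast
    have z: "?z \<in> Hom C A D" using that n comp_hom by blast
    have dbl: "?z \<boxplus> ?z = ?z" using comp_plus[OF n n that(1)] plus_null[OF n] by simp
    obtain w where w: "w \<in> Hom C A D" "?z \<boxplus> w = Null C A D" using plus_inv[OF z] by blast
    have "?z = ?z \<boxplus> (?z \<boxplus> w)" using w z plus_null by simp
    also have "\<dots> = Null C A D" using plus_assoc[OF z z w(1)] dbl w by simp
    finally show ?thesis .
  qed
  have cancel: "x = y" if v: "v \<in> Hom C A B" and "x \<in> Hom C A B" "y \<in> Hom C A B" "v \<boxplus> x = v \<boxplus> y"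
    for v x y A B
  proof -
    obtain w where w: "w \<in> Hom C A B" "v \<boxplus> w = Null C A B" using plus_inv v by blast
    have wv: "w \<boxplus> v = Null C A B" using w v plus_comm by metis
    have "t = w \<boxplus> (v \<boxplus> t)" if t: "t \<in> Hom C A B" for t
    proof -
      have "A \<in> Obj C" "B \<in> Obj C" using t arr_ends by (auto simp: Hom_def)
      then have "Null C A B \<boxplus> t = t" using plus_comm[OF null_hom t] plus_null[OF t] by simp
      then show ?thesis using plus_assoc[OF w(1) v t] wv by simp
    qed
    then show ?thesis using that by metis
  qed
  have eqs: "Obj (mor_cat C) = Arr C"
    "Arrow f g u \<boxplus>\<^bsub>mor_cat C\<^esub> Arrow f' g' u' = Arrow f g (fst u \<boxplus> fst u', snd u \<boxplus> snd u')"
    "Arrow f g u \<cdot>\<^bsub>mor_cat C\<^esub> Arrow f' g' u' = Arrow f' g (fst u \<cdot> fst u', snd u \<cdot> snd u')"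
    "Ident (mor_cat C) f = Arrow f f (Ident C (src f), Ident C (trg f))"
    "Null (mor_cat C) f g = Arrow f g (Null C (src f) (src g), Null C (trg f) (trg g))"
    for f g f' g' u u'
    by (simp_all add: mor_cat_def)
  show ?thesis
  proof
    fix u f g assume "u \<in> Hom (mor_cat C) f g"
    then obtain a b where u: "f \<in> Arr C" "g \<in> Arr C" "u = Arrow f g (a, b)"
      "a \<in> Hom C (src f) (src g)" "b \<in> Hom C (trg f) (trg g)" "b \<cdot> f = g \<cdot> a"
      by (auto simp: mem_Hom_mor_cat)
    obtain a' b' where a': "a' \<in> Hom C (src f) (src g)" "a \<boxplus> a' = Null C (src f) (src g)"
      and b': "b' \<in> Hom C (trg f) (trg g)" "b \<boxplus> b' = Null C (trg f) (trg g)"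
      using u plus_inv by meson
    have "b \<cdot> f \<boxplus> b' \<cdot> f = b \<cdot> f \<boxplus> g \<cdot> a'"
      using plus_comp[OF u(5) b'(1) arr(1)[OF u(1)]] comp_plus[OF u(4) a'(1) arr(1)[OF u(2)]]
        a' b' u null_comp[OF arr(1)[OF u(1)]] comp_null[OF arr(1)[OF u(2)]] arr by simp
    then have "b' \<cdot> f = g \<cdot> a'"
      using cancel comp_hom[OF arr(1)[OF u(1)]] comp_hom[OF _ arr(1)[OF u(2)]] u a' b' by blast
    then show "\<exists>v\<in>Hom (mor_cat C) f g. u \<boxplus>\<^bsub>mor_cat C\<^esub> v = Null (mor_cat C) f g"
      using u a' b' by (intro bexI[of _ "Arrow f g (a', b')"]) (auto simp: eqs mem_Hom_mor_cat)
  next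
    fix f g assume "f \<in> Obj (mor_cat C)" "g \<in> Obj (mor_cat C)"
    then show "Null (mor_cat C) f g \<in> Hom (mor_cat C) f g"
      by (auto simp: eqs mem_Hom_mor_cat arr null_comp[OF arr(1)] comp_null[OF arr(1)]
          intro: null_hom)
  next
    fix u v f g assume "u \<in> Hom (mor_cat C) f g" "v \<in> Hom (mor_cat C) f g"
    then show "u \<boxplus>\<^bsub>mor_cat C\<^esub> v \<in> Hom (mor_cat C) f g"
      using comp_plus[OF _ _ arr(1)] plus_comp[OF _ _ arr(1)]
      by (auto simp: eqs mem_Hom_mor_cat intro: plus_hom)
  next
    fix u v f g assume "u \<in> Hom (mor_cat C) f g" "v \<in> Hom (mor_cat C) f g"
    then show "u \<boxplus>\<^bsub>mor_cat C\<^esub> v = v \<boxplus>\<^bsub>mor_cat C\<^esub> u"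
      by (auto simp: eqs mem_Hom_mor_cat intro: plus_comm)
  next
    fix u v f g h assume "u \<in> Hom (mor_cat C) f g" "v \<in> Hom (mor_cat C) g h"
    then obtain a b a' b' where u: "f \<in> Arr C" "g \<in> Arr C" "h \<in> Arr C"
      "u = Arrow f g (a, b)" "v = Arrow g h (a', b')"
      "a \<in> Hom C (src f) (src g)" "b \<in> Hom C (trg f) (trg g)" "b \<cdot> f = g \<cdot> a"
      "a' \<in> Hom C (src g) (src h)" "b' \<in> Hom C (trg g) (trg h)" "b' \<cdot> g = h \<cdot> a'"
      by (auto simp: mem_Hom_mor_cat)
    have "b' \<cdot> b \<cdot> f = h \<cdot> (a' \<cdot> a)"
      using comp_assoc[OF arr(1)[OF u(1)] u(7) u(10)] comp_assoc[OF u(6) arr(1)[OF u(2)] u(10)]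
        comp_assoc[OF u(6) u(9) arr(1)[OF u(3)]] u by simp
    then show "v \<cdot>\<^bsub>mor_cat C\<^esub> u \<in> Hom (mor_cat C) f h"
      using u by (auto simp: eqs mem_Hom_mor_cat intro: comp_hom)
  next
    fix f assume "f \<in> Obj (mor_cat C)"
    then show "Ident (mor_cat C) f \<in> Hom (mor_cat C) f f"
      using arr id_comp[OF arr(1)] comp_id[OF arr(1)]
      by (auto simp: eqs mem_Hom_mor_cat intro: id_hom)
  next
    fix u assume "u \<in> Arr (mor_cat C)"
    then show "src u \<in> Obj (mor_cat C) \<and> trg u \<in> Obj (mor_cat C)"
      by (auto simp: mor_cat_def)
  qed (auto simp: eqs mem_Hom_mor_cat intro: comp_id id_comp comp_assoc plus_assoc plus_null
      comp_plus plus_comp)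
qed

definition S_obj :: "('o, 'f) precat \<Rightarrow> 'o set \<Rightarrow> ('o, 'f) arrow set" where
  "S_obj C \<X> = {f. is_mono C f \<and> src f \<in> \<X> \<and> trg f \<in> \<X> \<and>
    (\<exists>c. is_cokernel C c f \<and> trg c \<in> \<X>)}"

definition S_cat ::
    "('o, 'f) precat \<Rightarrow> 'o set \<Rightarrow> (('o, 'f) arrow, ('o, 'f) arrow \<times> ('o, 'f) arrow) precat" where
  "S_cat C \<X> = full_subcat (mor_cat C) (S_obj C \<X>)"

definition E_cw :: "('o, 'f) precat \<Rightarrow> 'o set \<Rightarrow>
    ((('o, 'f) arrow, ('o, 'f) arrow \<times> ('o, 'f) arrow) arrow \<times>
     (('o, 'f) arrow, ('o, 'f) arrow \<times> ('o, 'f) arrow) arrow) set" where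
  "E_cw C \<X> = {(i, p). short_exact (mor_cat C) i p \<and>
    src i \<in> S_obj C \<X> \<and> src p \<in> S_obj C \<X> \<and> trg p \<in> S_obj C \<X> \<and>
    split_exact C (fst (und i)) (fst (und p)) \<and> split_exact C (snd (und i)) (snd (und p))}"


section \<open>Artin algebras and their finitely generated right modules\<close>

definition artinian_cring :: "('k, 'x) ring_scheme \<Rightarrow> bool" where
  "artinian_cring K \<longleftrightarrow> cring K \<and>
    (\<forall>I :: nat \<Rightarrow> 'k set. (\<forall>n. ideal (I n) K) \<longrightarrow> antimono I \<longrightarrow> (\<exists>n. \<forall>m\<ge>n. I m = I n))"

text \<open>\<open>K\<close> acts on \<open>\<Lambda>\<close> through the ring homomorphism \<open>\<phi>\<close> into the centre of \<open>\<Lambda>\<close>.\<close>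

definition artin_algebra ::
    "('k, 'x) ring_scheme \<Rightarrow> ('a, 'y) ring_scheme \<Rightarrow> ('k \<Rightarrow> 'a) \<Rightarrow> bool" where
  "artin_algebra K \<Lambda> \<phi> \<longleftrightarrow> artinian_cring K \<and> ring \<Lambda> \<and> \<phi> \<in> ring_hom K \<Lambda> \<and>
    (\<forall>c\<in>carrier K. \<forall>x\<in>carrier \<Lambda>. \<phi> c \<otimes>\<^bsub>\<Lambda>\<^esub> x = x \<otimes>\<^bsub>\<Lambda>\<^esub> \<phi> c) \<and>
    (\<exists>S. finite S \<and> S \<subseteq> carrier \<Lambda> \<and>
      (\<forall>x\<in>carrier \<Lambda>. \<exists>c\<in>S \<rightarrow> carrier K. x = (\<Oplus>\<^bsub>\<Lambda>\<^esub>s\<in>S. \<phi> (c s) \<otimes>\<^bsub>\<Lambda>\<^esub> s)))"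

text \<open>The record type of HOL-Algebra modules is reused for right modules: \<open>r \<odot>\<^bsub>M\<^esub> x\<close> stands for
  \<open>x r\<close>, whence the order of the factors in \<open>act_assoc\<close>. The fields \<open>mult\<close> and \<open>one\<close> of the
  record play no role.\<close>

locale right_module = R?: ring R + M?: abelian_group M
  for R :: "('a, 'x) ring_scheme" (structure) and M :: "('a, 'b, 'y) module_scheme" (structure) +
  assumes act_closed: "\<lbrakk>r \<in> carrier R; x \<in> carrier M\<rbrakk> \<Longrightarrow> r \<odot>\<^bsub>M\<^esub> x \<in> carrier M"
    and act_l_distr: "\<lbrakk>r \<in> carrier R; s \<in> carrier R; x \<in> carrier M\<rbrakk>
      \<Longrightarrow> (r \<oplus>\<^bsub>R\<^esub> s) \<odot>\<^bsub>M\<^esub> x = r \<odot>\<^bsub>M\<^esub> x \<oplus>\<^bsub>M\<^esub> s \<odot>\<^bsub>M\<^esub> x"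
    and act_r_distr: "\<lbrakk>r \<in> carrier R; x \<in> carrier M; y \<in> carrier M\<rbrakk>
      \<Longrightarrow> r \<odot>\<^bsub>M\<^esub> (x \<oplus>\<^bsub>M\<^esub> y) = r \<odot>\<^bsub>M\<^esub> x \<oplus>\<^bsub>M\<^esub> r \<odot>\<^bsub>M\<^esub> y"
    and act_assoc: "\<lbrakk>r \<in> carrier R; s \<in> carrier R; x \<in> carrier M\<rbrakk>
      \<Longrightarrow> (r \<otimes>\<^bsub>R\<^esub> s) \<odot>\<^bsub>M\<^esub> x = s \<odot>\<^bsub>M\<^esub> (r \<odot>\<^bsub>M\<^esub> x)"
    and act_one: "x \<in> carrier M \<Longrightarrow> \<one>\<^bsub>R\<^esub> \<odot>\<^bsub>M\<^esub> x = x"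

definition fg_right_module ::
    "('a, 'x) ring_scheme \<Rightarrow> ('a, 'b, 'y) module_scheme \<Rightarrow> bool" where
  "fg_right_module R M \<longleftrightarrow> right_module R M \<and>
    (\<exists>S. finite S \<and> S \<subseteq> carrier M \<and>
      (\<forall>x\<in>carrier M. \<exists>c\<in>S \<rightarrow> carrier R. x = (\<Oplus>\<^bsub>M\<^esub>s\<in>S. c s \<odot>\<^bsub>M\<^esub> s)))"

definition linear_map :: "('a, 'x) ring_scheme \<Rightarrow> ('a, 'b, 'y) module_scheme \<Rightarrow>
    ('a, 'c, 'z) module_scheme \<Rightarrow> ('b \<Rightarrow> 'c) \<Rightarrow> bool" where
  "linear_map R M N f \<longleftrightarrow> f \<in> carrier M \<rightarrow> carrier N \<and>
    (\<forall>x\<in>carrier M. \<forall>y\<in>carrier M. f (x \<oplus>\<^bsub>M\<^esub> y) = f x \<oplus>\<^bsub>N\<^esub> f y) \<and>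
    (\<forall>r\<in>carrier R. \<forall>x\<in>carrier M. f (r \<odot>\<^bsub>M\<^esub> x) = r \<odot>\<^bsub>N\<^esub> f x)"

text \<open>The objects are the finitely generated right modules with underlying set in
  \<^typ>\<open>'a list\<close>; by \<open>mod_cat_adequate\<close> below this contains every finitely generated right
  module, on whatever type, up to isomorphism. Underlying functions are extensional, so that
  equality of arrows is equality of maps on the carrier.\<close>

definition mod_cat ::
    "('a, 'x) ring_scheme \<Rightarrow> (('a, 'a list) module, 'a list \<Rightarrow> 'a list) precat" where
  "mod_cat R = \<lparr>
    Obj = {M. fg_right_module R M},
    Arr = {Arrow M N f | M N f. fg_right_module R M \<and> fg_right_module R N \<and>
      linear_map R M N f \<and> f \<in> extensional (carrier M)},
    Comp = (\<lambda>g f. Arrow (src f) (trg g) (compose (carrier (src f)) (und g) (und f))),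
    Ident = (\<lambda>M. Arrow M M (\<lambda>x\<in>carrier M. x)),
    Plus = (\<lambda>f g. Arrow (src f) (trg f)
      (\<lambda>x\<in>carrier (src f). und f x \<oplus>\<^bsub>trg f\<^esub> und g x)),
    Null = (\<lambda>M N. Arrow M N (\<lambda>x\<in>carrier M. \<zero>\<^bsub>N\<^esub>))\<rparr>"

lemma linear_map_zero:
  assumes "right_module R M" "right_module R N" "linear_map R M N f"
  shows "f \<zero>\<^bsub>M\<^esub> = \<zero>\<^bsub>N\<^esub>"
proof -
  interpret M: abelian_group M using assms(1) by (rule right_module.axioms)
  interpret N: abelian_group N using assms(2) by (rule right_module.axioms)
  have c: "f \<zero>\<^bsub>M\<^esub> \<in> carrier N" using assms(3) by (auto simp: linear_map_def)
  have "f \<zero>\<^bsub>M\<^esub> \<oplus>\<^bsub>N\<^esub> f \<zero>\<^bsub>M\<^esub> = f \<zero>\<^bsub>M\<^esub>"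
    using assms(3) by (metis M.l_zero M.zero_closed linear_map_def)
  then show ?thesis using c by simp
qed

lemma linear_map_finsum:
  assumes "right_module R M" "right_module R N" "linear_map R M N f"
    and "finite S" "u \<in> S \<rightarrow> carrier M"
  shows "f (\<Oplus>\<^bsub>M\<^esub>s\<in>S. u s) = (\<Oplus>\<^bsub>N\<^esub>s\<in>S. f (u s))"
proof -
  interpret M: abelian_group M using assms(1) by (rule right_module.axioms)
  interpret N: abelian_group N using assms(2) by (rule right_module.axioms)
  have c: "f x \<in> carrier N" if "x \<in> carrier M" for x
    using assms(3) that by (auto simp: linear_map_def)
  show ?thesis using assms(4,5)
  proof (induction S rule: finite_induct)
    case empty
    then show ?case using linear_map_zero[OF assms(1-3)] by simp
  next
    case (insert a S)
    have u: "u \<in> S \<rightarrow> carrier M" "u a \<in> carrier M" using insert.prems by auto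
    then have fu: "(\<lambda>s. f (u s)) \<in> S \<rightarrow> carrier N" "f (u a) \<in> carrier N" using c by auto
    have "f (\<Oplus>\<^bsub>M\<^esub>s\<in>insert a S. u s) = f (u a \<oplus>\<^bsub>M\<^esub> (\<Oplus>\<^bsub>M\<^esub>s\<in>S. u s))"
      using insert u by simp
    also have "\<dots> = f (u a) \<oplus>\<^bsub>N\<^esub> f (\<Oplus>\<^bsub>M\<^esub>s\<in>S. u s)"
      using assms(3) u by (simp add: linear_map_def)
    also have "\<dots> = (\<Oplus>\<^bsub>N\<^esub>s\<in>insert a S. f (u s))"
      using insert u fu by simp
    finally show ?case .
  qed
qed

theorem mod_cat_adequate:
  fixes R :: "('a, 'x) ring_scheme" and M :: "('a, 'b, 'y) module_scheme"
  assumes fg: "fg_right_module R M"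
  shows "\<exists>N\<in>Obj (mod_cat R). \<exists>f. linear_map R M N f \<and> bij_betw f (carrier M) (carrier N)"
proof -
  have rM: "right_module R M" using fg by (simp add: fg_right_module_def)
  interpret right_module R M by (rule rM)
  obtain S where S: "finite S" "S \<subseteq> carrier M"
    and gen: "\<forall>x\<in>carrier M. \<exists>c\<in>S \<rightarrow> carrier R. x = (\<Oplus>\<^bsub>M\<^esub>s\<in>S. c s \<odot>\<^bsub>M\<^esub> s)"
    using fg by (auto simp: fg_right_module_def)
  obtain c where c: "\<And>x. x \<in> carrier M \<Longrightarrow> c x \<in> S \<rightarrow> carrier R"
      "\<And>x. x \<in> carrier M \<Longrightarrow> x = (\<Oplus>\<^bsub>M\<^esub>s\<in>S. c x s \<odot>\<^bsub>M\<^esub> s)"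
    using gen by metis
  obtain ss where ss: "set ss = S" using S(1) finite_list by blast
  define h where "h x = map (c x) ss" for x
  have inj: "inj_on h (carrier M)"
  proof (rule inj_onI)
    fix x y assume x: "x \<in> carrier M" and y: "y \<in> carrier M" and "h x = h y"
    then have eq: "\<And>s. s \<in> S \<Longrightarrow> c x s = c y s" by (auto simp: h_def ss[symmetric])
    have "(\<Oplus>\<^bsub>M\<^esub>s\<in>S. c x s \<odot>\<^bsub>M\<^esub> s) = (\<Oplus>\<^bsub>M\<^esub>s\<in>S. c y s \<odot>\<^bsub>M\<^esub> s)"
      by (rule M.finsum_cong') (use eq c(1)[OF y] S(2) in \<open>auto intro!: act_closed\<close>)
    then show "x = y" using c(2)[OF x] c(2)[OF y] by simp
  qed
  define g where "g = inv_into (carrier M) h"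
  have gh: "g (h x) = x" if "x \<in> carrier M" for x
    using inj that by (simp add: g_def)
  define N :: "('a, 'a list) module" where
    "N = \<lparr>carrier = h ` carrier M, mult = undefined, one = undefined, zero = h \<zero>\<^bsub>M\<^esub>,
      add = (\<lambda>u v. h (g u \<oplus>\<^bsub>M\<^esub> g v)), smult = (\<lambda>r u. h (r \<odot>\<^bsub>M\<^esub> g u))\<rparr>"
  have agN: "abelian_group N"
  proof (rule abelian_groupI)
    fix u assume "u \<in> carrier N"
    then obtain x where x: "x \<in> carrier M" "u = h x" by (auto simp: N_def)
    then have "h (\<ominus>\<^bsub>M\<^esub> x) \<in> carrier N" "h (\<ominus>\<^bsub>M\<^esub> x) \<oplus>\<^bsub>N\<^esub> u = \<zero>\<^bsub>N\<^esub>"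
      by (auto simp: N_def gh M.l_neg)
    then show "\<exists>v\<in>carrier N. v \<oplus>\<^bsub>N\<^esub> u = \<zero>\<^bsub>N\<^esub>" by blast
  qed (auto simp: N_def gh M.a_ac)
  have rN: "right_module R N"
    by (intro right_module.intro agN R.ring_axioms right_module_axioms.intro)
      (auto simp: N_def gh act_closed act_l_distr act_r_distr act_assoc act_one)
  have lin: "linear_map R M N h"
    by (auto simp: linear_map_def N_def gh)
  have "\<exists>d\<in>h ` S \<rightarrow> carrier R. u = (\<Oplus>\<^bsub>N\<^esub>t\<in>h ` S. d t \<odot>\<^bsub>N\<^esub> t)" if u: "u \<in> carrier N" for u
  proof -
    obtain x where x: "x \<in> carrier M" "u = h x" using u by (auto simp: N_def)
    interpret N: abelian_group N by (rule agN)
    have cl: "c x s \<in> carrier R" if "s \<in> S" for s using c(1)[OF x(1)] that by auto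
    have gS: "g (h s) = s" if "s \<in> S" for s using gh S(2) that by auto
    let ?d = "\<lambda>t. c x (g t)"
    have "u = h (\<Oplus>\<^bsub>M\<^esub>s\<in>S. c x s \<odot>\<^bsub>M\<^esub> s)" using c(2)[OF x(1)] x(2) by simp
    also have "\<dots> = (\<Oplus>\<^bsub>N\<^esub>s\<in>S. h (c x s \<odot>\<^bsub>M\<^esub> s))"
      by (rule linear_map_finsum[OF rM rN lin S(1)]) (use cl S(2) in \<open>auto intro!: act_closed\<close>)
    also have "\<dots> = (\<Oplus>\<^bsub>N\<^esub>s\<in>S. ?d (h s) \<odot>\<^bsub>N\<^esub> h s)"
      by (rule N.finsum_cong') (use cl gS S(2) in \<open>auto simp: N_def intro!: act_closed imageI\<close>)
    also have "\<dots> = (\<Oplus>\<^bsub>N\<^esub>t\<in>h ` S. ?d t \<odot>\<^bsub>N\<^esub> t)"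
      by (rule N.add.finprod_reindex[symmetric])
        (use cl gS S(2) inj in \<open>auto simp: N_def intro!: act_closed imageI intro: inj_on_subset\<close>)
    finally show ?thesis using cl gS by (intro bexI[of _ ?d]) auto
  qed
  then have "fg_right_module R N"
    unfolding fg_right_module_def using rN S
    by (intro conjI exI[of _ "h ` S"]) (auto simp: N_def)
  moreover have "bij_betw h (carrier M) (carrier N)"
    using inj by (simp add: bij_betw_def N_def)
  ultimately show ?thesis using lin by (auto simp: mod_cat_def)
qed

lemma mem_Hom_mod_cat:
  "\<alpha> \<in> Hom (mod_cat R) M N \<longleftrightarrow> fg_right_module R M \<and> fg_right_module R N \<and>
    (\<exists>f. \<alpha> = Arrow M N f \<and> linear_map R M N f \<and> f \<in> extensional (carrier M))"
  by (auto simp: Hom_def mod_cat_def)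

lemma mod_cat_preadditive: "preadditive_category (mod_cat R)"
proof
  fix f A B assume "f \<in> Hom (mod_cat R) A B"
  then obtain u where u: "fg_right_module R A" "fg_right_module R B" "f = Arrow A B u"
    "linear_map R A B u" "u \<in> extensional (carrier A)" by (auto simp: mem_Hom_mod_cat)
  interpret A: right_module R A using u(1) by (simp add: fg_right_module_def)
  interpret B: right_module R B using u(2) by (simp add: fg_right_module_def)
  have cl: "u x \<in> carrier B" if "x \<in> carrier A" for x
    using u(4) that by (auto simp: linear_map_def)
  let ?v = "\<lambda>x\<in>carrier A. \<ominus>\<^bsub>B\<^esub> u x"
  have act_neg: "\<ominus>\<^bsub>B\<^esub> (r \<odot>\<^bsub>B\<^esub> y) = r \<odot>\<^bsub>B\<^esub> (\<ominus>\<^bsub>B\<^esub> y)" if "r \<in> carrier R" "y \<in> carrier B" for r y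
  proof -
    have z: "r \<odot>\<^bsub>B\<^esub> \<zero>\<^bsub>B\<^esub> = \<zero>\<^bsub>B\<^esub>"
      using B.act_r_distr[of r "\<zero>\<^bsub>B\<^esub>" "\<zero>\<^bsub>B\<^esub>"] B.act_closed[of r "\<zero>\<^bsub>B\<^esub>"] that by simp
    have "r \<odot>\<^bsub>B\<^esub> (\<ominus>\<^bsub>B\<^esub> y) \<oplus>\<^bsub>B\<^esub> r \<odot>\<^bsub>B\<^esub> y = r \<odot>\<^bsub>B\<^esub> (\<ominus>\<^bsub>B\<^esub> y \<oplus>\<^bsub>B\<^esub> y)"
      using that by (simp add: B.act_r_distr)
    also have "\<dots> = \<zero>\<^bsub>B\<^esub>" using that z by (simp add: B.M.l_neg)
    finally show ?thesis
      using that by (intro B.M.minus_equality) (auto simp: B.act_closed)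
  qed
  have "linear_map R A B ?v"
    using u(4) cl by (auto simp: linear_map_def A.act_closed B.M.minus_add B.M.a_comm act_neg)
  then have "Arrow A B ?v \<in> Hom (mod_cat R) A B"
    using u by (auto simp: mem_Hom_mod_cat)
  moreover have "f \<boxplus>\<^bsub>mod_cat R\<^esub> Arrow A B ?v = Null (mod_cat R) A B"
    using u cl by (auto simp: mod_cat_def B.M.r_neg intro!: restrict_ext)
  ultimately show "\<exists>g\<in>Hom (mod_cat R) A B. f \<boxplus>\<^bsub>mod_cat R\<^esub> g = Null (mod_cat R) A B"
    by blast
next
  fix A B assume "A \<in> Obj (mod_cat R)" "B \<in> Obj (mod_cat R)"
  then have fg: "fg_right_module R A" "fg_right_module R B" by (simp_all add: mod_cat_def)
  interpret A: right_module R A using fg by (simp add: fg_right_module_def)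
  interpret B: right_module R B using fg by (simp add: fg_right_module_def)
  have "r \<odot>\<^bsub>B\<^esub> \<zero>\<^bsub>B\<^esub> = \<zero>\<^bsub>B\<^esub>" if "r \<in> carrier R" for r
    using B.act_r_distr[of r "\<zero>\<^bsub>B\<^esub>" "\<zero>\<^bsub>B\<^esub>"] B.act_closed[of r "\<zero>\<^bsub>B\<^esub>"] that by simp
  then show "Null (mod_cat R) A B \<in> Hom (mod_cat R) A B"
    unfolding mem_Hom_mod_cat using fg
    by (auto simp: mod_cat_def linear_map_def A.act_closed)
next
  fix f g A B assume "f \<in> Hom (mod_cat R) A B" "g \<in> Hom (mod_cat R) A B"
  then obtain u v where u: "fg_right_module R A" "fg_right_module R B" "f = Arrow A B u"
    "linear_map R A B u" and v: "g = Arrow A B v" "linear_map R A B v"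
    by (auto simp: mem_Hom_mod_cat)
  interpret A: right_module R A using u(1) by (simp add: fg_right_module_def)
  interpret B: right_module R B using u(2) by (simp add: fg_right_module_def)
  have cl: "u x \<in> carrier B" "v x \<in> carrier B" if "x \<in> carrier A" for x
    using u(4) v(2) that by (auto simp: linear_map_def)
  have "linear_map R A B (\<lambda>x\<in>carrier A. u x \<oplus>\<^bsub>B\<^esub> v x)"
    using u(4) v(2) cl by (auto simp: linear_map_def A.act_closed B.act_r_distr B.M.a_ac)
  then show "f \<boxplus>\<^bsub>mod_cat R\<^esub> g \<in> Hom (mod_cat R) A B"
    using u v unfolding mem_Hom_mod_cat by (auto simp: mod_cat_def)
  show "f \<boxplus>\<^bsub>mod_cat R\<^esub> g = g \<boxplus>\<^bsub>mod_cat R\<^esub> f"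
    using u v cl by (auto simp: mod_cat_def B.M.a_comm intro!: restrict_ext)
next
  fix f g h A B D
  assume "f \<in> Hom (mod_cat R) B D" "g \<in> Hom (mod_cat R) B D" "h \<in> Hom (mod_cat R) A B"
  then show "(f \<boxplus>\<^bsub>mod_cat R\<^esub> g) \<cdot>\<^bsub>mod_cat R\<^esub> h = f \<cdot>\<^bsub>mod_cat R\<^esub> h \<boxplus>\<^bsub>mod_cat R\<^esub> g \<cdot>\<^bsub>mod_cat R\<^esub> h"
    unfolding mem_Hom_mod_cat by (auto simp: mod_cat_def compose_def linear_map_def fun_eq_iff)
next
  fix f g h A B D
  assume "f \<in> Hom (mod_cat R) A B" "g \<in> Hom (mod_cat R) A B" "h \<in> Hom (mod_cat R) B D"
  then show "h \<cdot>\<^bsub>mod_cat R\<^esub> (f \<boxplus>\<^bsub>mod_cat R\<^esub> g) = h \<cdot>\<^bsub>mod_cat R\<^esub> f \<boxplus>\<^bsub>mod_cat R\<^esub> h \<cdot>\<^bsub>mod_cat R\<^esub> g"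
    unfolding mem_Hom_mod_cat
    by (auto simp: mod_cat_def compose_def linear_map_def Pi_iff fun_eq_iff)
next
  fix f g h A B
  assume "f \<in> Hom (mod_cat R) A B" "g \<in> Hom (mod_cat R) A B" "h \<in> Hom (mod_cat R) A B"
  then obtain u v w where u: "fg_right_module R B" "f = Arrow A B u" "g = Arrow A B v"
    "h = Arrow A B w" "linear_map R A B u" "linear_map R A B v" "linear_map R A B w"
    by (auto simp: mem_Hom_mod_cat)
  interpret B: right_module R B using u(1) by (simp add: fg_right_module_def)
  show "f \<boxplus>\<^bsub>mod_cat R\<^esub> g \<boxplus>\<^bsub>mod_cat R\<^esub> h = f \<boxplus>\<^bsub>mod_cat R\<^esub> (g \<boxplus>\<^bsub>mod_cat R\<^esub> h)"
    using u by (auto simp: mod_cat_def linear_map_def Pi_iff fun_eq_iff B.M.a_assoc)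
next
  fix f A B assume "f \<in> Hom (mod_cat R) A B"
  then obtain u where u: "fg_right_module R B" "f = Arrow A B u"
    "linear_map R A B u" "u \<in> extensional (carrier A)"
    by (auto simp: mem_Hom_mod_cat)
  interpret B: right_module R B using u(1) by (simp add: fg_right_module_def)
  show "f \<boxplus>\<^bsub>mod_cat R\<^esub> Null (mod_cat R) A B = f"
    using u by (auto simp: mod_cat_def linear_map_def Pi_iff fun_eq_iff extensional_def)
next
  fix f g h A B D E
  assume "f \<in> Hom (mod_cat R) A B" "g \<in> Hom (mod_cat R) B D" "h \<in> Hom (mod_cat R) D E"
  then show "h \<cdot>\<^bsub>mod_cat R\<^esub> g \<cdot>\<^bsub>mod_cat R\<^esub> f = h \<cdot>\<^bsub>mod_cat R\<^esub> (g \<cdot>\<^bsub>mod_cat R\<^esub> f)"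
    unfolding mem_Hom_mod_cat
    by (auto simp: mod_cat_def compose_def linear_map_def Pi_iff fun_eq_iff)
next
  fix f A B assume "f \<in> Hom (mod_cat R) A B"
  then show "f \<cdot>\<^bsub>mod_cat R\<^esub> Ident (mod_cat R) A = f"
    "Ident (mod_cat R) B \<cdot>\<^bsub>mod_cat R\<^esub> f = f"
    unfolding mem_Hom_mod_cat
    by (auto simp: mod_cat_def compose_def linear_map_def Pi_iff fun_eq_iff extensional_def)
next
  fix f g A B D assume "f \<in> Hom (mod_cat R) A B" "g \<in> Hom (mod_cat R) B D"
  then show "g \<cdot>\<^bsub>mod_cat R\<^esub> f \<in> Hom (mod_cat R) A D"
    unfolding mem_Hom_mod_cat
    by (auto simp: mod_cat_def compose_def linear_map_def Pi_iff fg_right_module_def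
        abelian_group.axioms abelian_monoid.a_closed[OF abelian_group.axioms(1)[OF right_module.axioms(2)]]
        right_module.act_closed)
next
  fix A assume "A \<in> Obj (mod_cat R)"
  then show "Ident (mod_cat R) A \<in> Hom (mod_cat R) A A"
    unfolding mem_Hom_mod_cat
    by (auto simp: mod_cat_def linear_map_def fg_right_module_def
        abelian_monoid.a_closed[OF abelian_group.axioms(1)[OF right_module.axioms(2)]]
        right_module.act_closed)
next
  fix f assume "f \<in> Arr (mod_cat R)"
  then show "src f \<in> Obj (mod_cat R) \<and> trg f \<in> Obj (mod_cat R)"
    by (auto simp: mod_cat_def)
qed

end

theory Submission
  imports Defs
begin

text \<open>
  An object of the category \<open>\<S>\<close> in question is a monomorphism \<open>f : A \<rightarrow> B\<close> with
  \<open>A\<close>, \<open>B\<close> and \<open>D = Cok f\<close> in \<open>\<X>\<close>, and a deflation is a commutative square whose two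
  components are split epimorphisms. This makes \<open>1\<^sub>X\<close> and \<open>0 \<rightarrow> X\<close> projective: a morphism out of \<open>1\<^sub>X\<close> is determined by its first component, a
  morphism out of \<open>0 \<rightarrow> X\<close> by its second, and either component lifts along a splitting.

  Conversely, consider the deflation from the inclusion \<open>A \<rightarrow> A \<oplus> B\<close> to \<open>f\<close> that is the identity on
  \<open>A\<close> and \<open>(f, 1)\<close> on \<open>A \<oplus> B\<close>; its kernel is \<open>0 \<rightarrow> A\<close> (\<open>standard_conflation\<close>). The inclusion is the
  direct sum of \<open>1\<^sub>A\<close> and \<open>0 \<rightarrow> B\<close>, so it is projective and there are enough projectives. If \<open>f\<close> is
  itself projective, the deflation has a section, and composing the second component
  \<open>B \<rightarrow> A \<oplus> B\<close> of this section with the projection to \<open>A\<close> gives a retraction of \<open>f\<close>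
  (\<open>projective_imp_split_mono\<close>). A split monomorphism \<open>f\<close> is the direct sum of \<open>1\<^sub>A\<close> and
  \<open>0 \<rightarrow> D\<close> (\<open>split_mono_S_biproduct\<close>). If \<open>f\<close> is moreover indecomposable, one of the two summands
  vanishes and \<open>f\<close> is isomorphic to the other. Finally \<open>1\<^sub>X\<close> and \<open>0 \<rightarrow> X\<close> are
  indecomposable exactly when \<open>X\<close> is.

  The argument is carried out for a class \<open>\<X>\<close> of objects of a preadditive category that contains
  a zero object and is closed under biproducts and their summands. A resolving class of modules
  is of this kind, once direct sums of finitely generated modules are constructed.
\<close>

section \<open>Preadditive categories\<close>

context preadditive_category
begin

lemma arr_objD: "f \<in> Arr C \<Longrightarrow> src f \<in> Obj C" "f \<in> Arr C \<Longrightarrow> trg f \<in> Obj C"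
  using arr_ends by auto

lemma Hom_self: "f \<in> Arr C \<Longrightarrow> f \<in> Hom C (src f) (trg f)"
  by (simp add: Hom_def)

text \<open>The axioms speak of hom-sets whose end points a rewrite rule would have to guess. Stated
  with \<^const>\<open>src\<close> and \<^const>\<open>trg\<close>, they become conditional rewrite rules whose conditions
  the simplifier can discharge.\<close>

lemma comp_arr:
  assumes "f \<in> Arr C" "g \<in> Arr C" "trg f = src g"
  shows "g \<cdot> f \<in> Arr C" "src (g \<cdot> f) = src f" "trg (g \<cdot> f) = trg g"
  using comp_hom[of f "src f" "trg f" g "trg g"] assms by (auto simp: Hom_def)

lemma plus_arr:
  assumes "f \<in> Arr C" "g \<in> Arr C" "src f = src g" "trg f = trg g"
  shows "f \<boxplus> g \<in> Arr C" "src (f \<boxplus> g) = src g" "trg (f \<boxplus> g) = trg g"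
  using plus_hom[of f "src f" "trg f" g] assms by (auto simp: Hom_def)

lemma id_arr:
  assumes "A \<in> Obj C"
  shows "Ident C A \<in> Arr C" "src (Ident C A) = A" "trg (Ident C A) = A"
  using id_hom[OF assms] by (auto simp: Hom_def)

lemma null_arr:
  assumes "A \<in> Obj C" "B \<in> Obj C"
  shows "Null C A B \<in> Arr C" "src (Null C A B) = A" "trg (Null C A B) = B"
  using null_hom[OF assms] by (auto simp: Hom_def)

lemma comp_id_arr: "f \<in> Arr C \<Longrightarrow> src f = A \<Longrightarrow> f \<cdot> Ident C A = f"
  by (rule comp_id) (auto simp: Hom_def)

lemma id_comp_arr: "f \<in> Arr C \<Longrightarrow> trg f = A \<Longrightarrow> Ident C A \<cdot> f = f"
  by (rule id_comp) (auto simp: Hom_def)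

lemma assoc_arr:
  "\<lbrakk>f \<in> Arr C; g \<in> Arr C; h \<in> Arr C; trg f = src g; trg g = src h\<rbrakk>
    \<Longrightarrow> h \<cdot> g \<cdot> f = h \<cdot> (g \<cdot> f)"
  by (rule comp_assoc) (auto simp: Hom_def)

lemma comp_plus_arr:
  "\<lbrakk>f \<in> Arr C; g \<in> Arr C; h \<in> Arr C; src f = src g; trg f = src h; trg g = src h\<rbrakk>
    \<Longrightarrow> h \<cdot> (f \<boxplus> g) = h \<cdot> f \<boxplus> h \<cdot> g"
  by (rule comp_plus) (auto simp: Hom_def)

lemma plus_comp_arr:
  "\<lbrakk>f \<in> Arr C; g \<in> Arr C; h \<in> Arr C; trg f = trg g; trg h = src f; trg h = src g\<rbrakk>
    \<Longrightarrow> (f \<boxplus> g) \<cdot> h = f \<cdot> h \<boxplus> g \<cdot> h"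
  by (rule plus_comp) (auto simp: Hom_def)

lemma plus_null_arr: "\<lbrakk>f \<in> Arr C; src f = A; trg f = B\<rbrakk> \<Longrightarrow> f \<boxplus> Null C A B = f"
  by (rule plus_null) (auto simp: Hom_def)

lemma plus_comm_arr:
  "\<lbrakk>f \<in> Arr C; g \<in> Arr C; src f = src g; trg f = trg g\<rbrakk> \<Longrightarrow> f \<boxplus> g = g \<boxplus> f"
  by (rule plus_comm) (auto simp: Hom_def)

lemma plus_assoc_arr:
  "\<lbrakk>f \<in> Arr C; g \<in> Arr C; h \<in> Arr C; src f = src g; src g = src h; trg f = trg g; trg g = trg h\<rbrakk>
    \<Longrightarrow> f \<boxplus> g \<boxplus> h = f \<boxplus> (g \<boxplus> h)"
  by (rule plus_assoc) (auto simp: Hom_def)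

lemma null_plus_arr:
  assumes "f \<in> Arr C" "src f = A" "trg f = B"
  shows "Null C A B \<boxplus> f = f"
  using plus_comm[OF null_hom, of A B f] plus_null_arr assms arr_objD[OF assms(1)]
  by (simp add: Hom_def)

lemma plus_eq_left_imp_null:
  assumes x: "x \<in> Arr C" and y: "y \<in> Arr C" and xy: "src x = src y" "trg x = trg y" "y \<boxplus> x = y"
  shows "x = Null C (src y) (trg y)"
proof -
  obtain n where n: "n \<in> Arr C" "src n = src y" "trg n = trg y" "y \<boxplus> n = Null C (src y) (trg y)"
    using plus_inv[OF Hom_self[OF y]] by (auto simp: Hom_def)
  have "n \<boxplus> y \<boxplus> x = n \<boxplus> (y \<boxplus> x)" using n x y xy by (intro plus_assoc_arr) auto
  moreover have "n \<boxplus> y = Null C (src y) (trg y)" using n y plus_comm_arr[of n y] by simp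
  ultimately show ?thesis using x xy null_plus_arr[OF x refl refl] by simp
qed

lemma null_comp_arr:
  assumes "f \<in> Arr C" "trg f = B" "D \<in> Obj C"
  shows "Null C B D \<cdot> f = Null C (src f) D"
proof -
  have n: "Null C B D \<in> Arr C" "src (Null C B D) = B" "trg (Null C B D) = D"
    using assms arr_objD null_arr by auto
  have "Null C B D \<cdot> f \<boxplus> Null C B D \<cdot> f = (Null C B D \<boxplus> Null C B D) \<cdot> f"
    using n assms by (simp add: plus_comp_arr)
  then show ?thesis
    using plus_eq_left_imp_null[of "Null C B D \<cdot> f" "Null C B D \<cdot> f"] n assms plus_null_arr comp_arr
    by simp
qed

lemma comp_null_arr:
  assumes "f \<in> Arr C" "src f = B" "A \<in> Obj C"
  shows "f \<cdot> Null C A B = Null C A (trg f)"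
proof -
  have n: "Null C A B \<in> Arr C" "src (Null C A B) = A" "trg (Null C A B) = B"
    using assms arr_objD null_arr by auto
  have "f \<cdot> Null C A B \<boxplus> f \<cdot> Null C A B = f \<cdot> (Null C A B \<boxplus> Null C A B)"
    using n assms by (simp add: comp_plus_arr)
  then show ?thesis
    using plus_eq_left_imp_null[of "f \<cdot> Null C A B" "f \<cdot> Null C A B"] n assms plus_null_arr comp_arr
    by simp
qed

lemmas arrow_simps = arr_objD comp_arr plus_arr id_arr null_arr comp_id_arr id_comp_arr assoc_arr
  comp_plus_arr plus_comp_arr plus_null_arr null_plus_arr null_comp_arr comp_null_arr plus_assoc_arr

text \<open>The simplifier keeps composites bracketed to the right, where an equation \<open>g \<cdot> f = e\<close> no
  longer matches; this is the form in which it still applies.\<close>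

lemma comp_reduce:
  "\<lbrakk>g \<cdot> f = e; f \<in> Arr C; g \<in> Arr C; trg f = src g; x \<in> Arr C; trg x = src f\<rbrakk>
    \<Longrightarrow> g \<cdot> (f \<cdot> x) = e \<cdot> x"
  by (simp flip: assoc_arr)


subsection \<open>Zero objects, isomorphisms and retracts\<close>

lemma hom_from_zero: "is_zero C Z \<Longrightarrow> f \<in> Arr C \<Longrightarrow> src f = Z \<Longrightarrow> f = Null C Z (trg f)"
  unfolding is_zero_def by (metis comp_id_arr comp_null_arr)

lemma retract_of_zero:
  assumes "is_zero C A" "r \<in> Hom C A B" "s \<in> Hom C B A" "r \<cdot> s = Ident C B"
  shows "is_zero C B"
proof -
  have "r = Null C A B" using hom_from_zero assms by (auto simp: Hom_def)
  then show ?thesis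
    using assms arr_objD[of s] by (auto simp: Hom_def is_zero_def null_comp_arr)
qed

lemma isomorphicE:
  assumes "isomorphic C A B"
  obtains f g where "f \<in> Hom C A B" "g \<in> Hom C B A" "g \<cdot> f = Ident C A" "f \<cdot> g = Ident C B"
  using assms by (auto simp: isomorphic_def)

lemma isomorphic_sym: "isomorphic C A B \<Longrightarrow> isomorphic C B A"
  by (auto simp: isomorphic_def)

lemma projective_wrt_retract:
  assumes "projective_wrt C D P" "D \<subseteq> Arr C"
    and r: "r \<in> Hom C P Q" and s: "s \<in> Hom C Q P" and rs: "r \<cdot> s = Ident C Q"
  shows "projective_wrt C D Q"
  unfolding projective_wrt_def
proof (intro conjI ballI)
  show "Q \<in> Obj C" using s arr_objD by (auto simp: Hom_def)
  fix p f assume p: "p \<in> D" and f: "f \<in> Hom C Q (trg p)"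
  obtain g where g: "g \<in> Hom C P (src p)" "p \<cdot> g = f \<cdot> r"
    using assms(1) p comp_hom[OF r f] by (auto simp: projective_wrt_def)
  have "p \<cdot> (g \<cdot> s) = p \<cdot> g \<cdot> s"
    using p g s assms(2) by (intro assoc_arr[symmetric]) (auto simp: Hom_def)
  also have "\<dots> = f \<cdot> (r \<cdot> s)" using g f r s by (simp add: Hom_def assoc_arr)
  finally have "p \<cdot> (g \<cdot> s) = f" using rs f by (simp add: Hom_def comp_id_arr)
  then show "\<exists>g\<in>Hom C Q (src p). p \<cdot> g = f" using comp_hom[OF s g(1)] by blast
qed

lemma projective_wrt_isomorphic:
  "isomorphic C P Q \<Longrightarrow> D \<subseteq> Arr C \<Longrightarrow> projective_wrt C D P \<Longrightarrow> projective_wrt C D Q"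
  by (elim isomorphicE) (rule projective_wrt_retract)

lemma zero_projective:
  assumes "is_zero C Z" "D \<subseteq> Arr C"
  shows "projective_wrt C D Z"
  unfolding projective_wrt_def
proof (intro conjI ballI)
  show Z: "Z \<in> Obj C" using assms by (simp add: is_zero_def)
  fix p f assume p: "p \<in> D" and f: "f \<in> Hom C Z (trg p)"
  have "p \<cdot> Null C Z (src p) = f"
    using hom_from_zero[OF assms(1), of f] f p assms(2) Z by (auto simp: Hom_def comp_null_arr)
  then show "\<exists>g\<in>Hom C Z (src p). p \<cdot> g = f"
    using null_hom[OF Z, of "src p"] arr_objD p assms(2) by blast
qed


subsection \<open>Biproducts\<close>

text \<open>The structure maps are named because the same object carries several biproduct
  decompositions below, and it matters which maps belong to which.\<close>

definition biproduct_maps where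
  "biproduct_maps S A B i j p q \<longleftrightarrow>
    i \<in> Hom C A S \<and> j \<in> Hom C B S \<and> p \<in> Hom C S A \<and> q \<in> Hom C S B \<and>
    p \<cdot> i = Ident C A \<and> q \<cdot> j = Ident C B \<and>
    p \<cdot> j = Null C B A \<and> q \<cdot> i = Null C A B \<and> i \<cdot> p \<boxplus> j \<cdot> q = Ident C S"

lemma is_biproduct_iff_maps: "is_biproduct C S A B \<longleftrightarrow> (\<exists>i j p q. biproduct_maps S A B i j p q)"
proof
  assume "\<exists>i j p q. biproduct_maps S A B i j p q"
  then show "is_biproduct C S A B"
    unfolding is_biproduct_def biproduct_maps_def using arr_ends by (fastforce simp: Hom_def)
qed (auto simp: is_biproduct_def biproduct_maps_def)

lemma biproduct_decompose:
  assumes "biproduct_maps S A B i j p q"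
  shows "f \<in> Arr C \<Longrightarrow> src f = S \<Longrightarrow> f \<cdot> (i \<cdot> p) \<boxplus> f \<cdot> (j \<cdot> q) = f"
    and "g \<in> Arr C \<Longrightarrow> trg g = S \<Longrightarrow> i \<cdot> (p \<cdot> g) \<boxplus> j \<cdot> (q \<cdot> g) = g"
proof -
  note b = assms[unfolded biproduct_maps_def Hom_def, simplified]
  assume f: "f \<in> Arr C" "src f = S"
  have "f \<cdot> (i \<cdot> p) \<boxplus> f \<cdot> (j \<cdot> q) = f \<cdot> (i \<cdot> p \<boxplus> j \<cdot> q)"
    using b f by (intro comp_plus_arr[symmetric]) (auto simp: comp_arr)
  then show "f \<cdot> (i \<cdot> p) \<boxplus> f \<cdot> (j \<cdot> q) = f" using b f by (simp add: comp_id_arr)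
next
  note b = assms[unfolded biproduct_maps_def Hom_def, simplified]
  assume g: "g \<in> Arr C" "trg g = S"
  have "i \<cdot> (p \<cdot> g) \<boxplus> j \<cdot> (q \<cdot> g) = i \<cdot> p \<cdot> g \<boxplus> j \<cdot> q \<cdot> g"
    using b g by (simp add: assoc_arr)
  also have "\<dots> = (i \<cdot> p \<boxplus> j \<cdot> q) \<cdot> g"
    using b g by (intro plus_comp_arr[symmetric]) (auto simp: comp_arr)
  finally show "i \<cdot> (p \<cdot> g) \<boxplus> j \<cdot> (q \<cdot> g) = g" using b g by (simp add: id_comp_arr)
qed

lemma biproduct_maps_swap:
  assumes "biproduct_maps S A B i j p q"
  shows "biproduct_maps S B A j i q p"
  using assms by (auto simp: biproduct_maps_def Hom_def arrow_simps plus_comm_arr[of "j \<cdot> q" "i \<cdot> p"])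

lemma zero_biproduct_maps:
  assumes "is_zero C Z" "A \<in> Obj C"
  shows "biproduct_maps A A Z (Ident C A) (Null C Z A) (Ident C A) (Null C A Z)"
    and "biproduct_maps A Z A (Null C Z A) (Ident C A) (Null C A Z) (Ident C A)"
  using assms by (simp_all add: is_zero_def biproduct_maps_def Hom_def arrow_simps)

lemma biproduct_isomorphic:
  assumes "is_biproduct C S A B" "isomorphic C S T"
  shows "is_biproduct C T A B"
proof -
  obtain i j p q where b: "biproduct_maps S A B i j p q"
    using assms(1) by (auto simp: is_biproduct_iff_maps)
  obtain f g where fg: "f \<in> Hom C S T" "g \<in> Hom C T S" "g \<cdot> f = Ident C S" "f \<cdot> g = Ident C T"
    using assms(2) by (rule isomorphicE)
  note b' = b[unfolded biproduct_maps_def Hom_def, simplified]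
  note fg' = fg[unfolded Hom_def, simplified]
  have gf: "g \<cdot> (f \<cdot> x) = x" if "x \<in> Arr C" "trg x = S" for x
    using comp_reduce[OF fg(3)] that fg' by (simp add: id_comp_arr)
  have "f \<cdot> (i \<cdot> (p \<cdot> g)) \<boxplus> f \<cdot> (j \<cdot> (q \<cdot> g)) = f \<cdot> (i \<cdot> (p \<cdot> g) \<boxplus> j \<cdot> (q \<cdot> g))"
    using b' fg' by (simp add: arrow_simps)
  also have "\<dots> = Ident C T" using biproduct_decompose(2)[OF b, of g] fg' by simp
  finally have sum: "f \<cdot> (i \<cdot> (p \<cdot> g)) \<boxplus> f \<cdot> (j \<cdot> (q \<cdot> g)) = Ident C T" .
  have "biproduct_maps T A B (f \<cdot> i) (f \<cdot> j) (p \<cdot> g) (q \<cdot> g)"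
    using b' fg' sum by (simp add: biproduct_maps_def Hom_def arrow_simps gf)
  then show ?thesis by (auto simp: is_biproduct_iff_maps)
qed

lemma biproduct_with_zero:
  assumes "biproduct_maps S A B i j p q" "is_zero C A"
  shows "isomorphic C S B"
proof -
  note b = assms(1)[unfolded biproduct_maps_def Hom_def, simplified]
  have "i = Null C A S" using hom_from_zero[OF assms(2), of i] b by simp
  then have "i \<cdot> p = Null C S S" using b arr_objD[of i] by (auto simp: null_comp_arr)
  moreover have "Null C S S \<boxplus> j \<cdot> q = j \<cdot> q" using b by (simp add: arrow_simps)
  ultimately have "j \<cdot> q = Ident C S" using b by simp
  then show ?thesis using b arr_ends[of q] by (auto simp: isomorphic_def Hom_def)
qed

lemma is_biproduct_with_zero:
  assumes "is_biproduct C S A B" "is_zero C A \<or> is_zero C B"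
  shows "is_zero C A \<and> isomorphic C S B \<or> is_zero C B \<and> isomorphic C S A"
  using assms biproduct_with_zero biproduct_maps_swap by (metis is_biproduct_iff_maps)

lemma indecomposable_isomorphic:
  assumes "isomorphic C M N" "indecomposable C M"
  shows "indecomposable C N"
  unfolding indecomposable_def
proof (intro conjI allI impI)
  show "N \<in> Obj C" using assms by (simp add: isomorphic_def)
  show "\<not> is_zero C N"
    using assms retract_of_zero by (auto simp: isomorphic_def indecomposable_def)
  fix A B assume "is_biproduct C N A B"
  then show "is_zero C A \<or> is_zero C B"
    using assms biproduct_isomorphic isomorphic_sym unfolding indecomposable_def by blast
qed

lemma projective_wrt_biproduct:
  assumes "is_biproduct C S A B" "D \<subseteq> Arr C" "projective_wrt C D A" "projective_wrt C D B"
  shows "projective_wrt C D S"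
  unfolding projective_wrt_def
proof (intro conjI ballI)
  show "S \<in> Obj C" using assms(1) by (simp add: is_biproduct_def)
  obtain i j p q where bm: "biproduct_maps S A B i j p q"
    using assms(1) by (auto simp: is_biproduct_iff_maps)
  note b = bm[unfolded biproduct_maps_def Hom_def, simplified]
  fix d f assume "d \<in> D" and f': "f \<in> Hom C S (trg d)"
  then have d: "d \<in> D" "d \<in> Arr C" and f: "f \<in> Arr C" "src f = S" "trg f = trg d"
    using assms(2) by (auto simp: Hom_def)
  obtain g where g': "g \<in> Hom C A (src d)" and dg: "d \<cdot> g = f \<cdot> i"
    using assms(3) d(1) comp_hom[of i A S f "trg d"] b f' unfolding projective_wrt_def
    by (metis bm biproduct_maps_def)
  obtain h where h': "h \<in> Hom C B (src d)" and dh: "d \<cdot> h = f \<cdot> j"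
    using assms(4) d(1) comp_hom[of j B S f "trg d"] b f' unfolding projective_wrt_def
    by (metis bm biproduct_maps_def)
  have g: "g \<in> Arr C" "src g = A" "trg g = src d" and h: "h \<in> Arr C" "src h = B" "trg h = src d"
    using g' h' by (auto simp: Hom_def)
  have "d \<cdot> (g \<cdot> p \<boxplus> h \<cdot> q) = d \<cdot> g \<cdot> p \<boxplus> d \<cdot> h \<cdot> q"
    using g h b d(2) by (simp add: comp_plus_arr comp_arr assoc_arr)
  also have "\<dots> = f \<cdot> (i \<cdot> p) \<boxplus> f \<cdot> (j \<cdot> q)"
    unfolding dg dh using b f by (simp add: assoc_arr)
  also have "\<dots> = f" by (rule biproduct_decompose(1)[OF bm f(1,2)])
  finally have "d \<cdot> (g \<cdot> p \<boxplus> h \<cdot> q) = f" .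
  moreover have "g \<cdot> p \<boxplus> h \<cdot> q \<in> Hom C S (src d)"
    using g(1-3) h(1-3) b by (simp add: Hom_def comp_arr plus_arr)
  ultimately show "\<exists>g\<in>Hom C S (src d). d \<cdot> g = f" by blast
qed

lemma biproduct_split_exact:
  assumes "biproduct_maps S A B i j p q"
  shows "split_exact C i q"
proof -
  note b = assms[unfolded biproduct_maps_def Hom_def, simplified]
  have pi: "p \<cdot> (i \<cdot> x) = x" if "x \<in> Arr C" "trg x = A" for x
    using comp_reduce[of p i] that b by (simp add: id_comp_arr)
  have qj: "x \<cdot> q \<cdot> j = x" if "x \<in> Arr C" "src x = B" for x
    using that b by (simp add: arrow_simps)
  have ker: "is_kernel C i q"
    unfolding is_kernel_def
  proof (intro conjI ballI impI)
    fix W g assume W: "W \<in> Obj C" and g: "g \<in> Hom C W (src q)" "q \<cdot> g = Null C W (trg q)"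
    have "i \<cdot> (p \<cdot> g) = g"
      using biproduct_decompose(2)[OF assms, of g] g b W arr_objD[of i]
      by (auto simp: Hom_def arrow_simps)
    moreover have "p \<cdot> g \<in> Hom C W (src i)" using g b by (auto simp: Hom_def comp_arr)
    moreover have "h = p \<cdot> g" if "h \<in> Hom C W (src i)" "i \<cdot> h = g" for h
      using pi[of h] that b by (auto simp: Hom_def)
    ultimately show "\<exists>!h. h \<in> Hom C W (src i) \<and> i \<cdot> h = g" by blast
  qed (use b in auto)
  have cok: "is_cokernel C q i"
    unfolding is_cokernel_def
  proof (intro conjI ballI impI)
    fix W g assume W: "W \<in> Obj C" and g: "g \<in> Hom C (trg i) W" "g \<cdot> i = Null C (src i) W"
    have "g \<cdot> (i \<cdot> p) = Null C (src p) W"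
    proof -
      have "g \<cdot> (i \<cdot> p) = g \<cdot> i \<cdot> p"
        using g(1) b by (intro assoc_arr[symmetric]) (auto simp: Hom_def)
      also have "\<dots> = Null C (src p) W"
        unfolding g(2) using b W by (simp add: null_comp_arr)
      finally show ?thesis .
    qed
    then have "g \<cdot> j \<cdot> q = g"
      using biproduct_decompose(1)[OF assms, of g] g(1) b W by (auto simp: Hom_def arrow_simps)
    moreover have "g \<cdot> j \<in> Hom C (trg q) W" using g b by (auto simp: Hom_def comp_arr)
    moreover have "h = g \<cdot> j" if "h \<in> Hom C (trg q) W" "h \<cdot> q = g" for h
      using qj[of h] that b by (auto simp: Hom_def)
    ultimately show "\<exists>!h. h \<in> Hom C (trg q) W \<and> h \<cdot> q = g" by blast
  qed (use b in auto)
  show ?thesis using ker cok b by (auto simp: split_exact_def short_exact_def Hom_def)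
qed

text \<open>A morphism \<open>f : A \<rightarrow> B\<close> shears \<open>A \<oplus> B\<close>: replacing the second projection by \<open>(f, 1)\<close> and the
  first injection by \<open>(1, -f)\<close> gives another biproduct decomposition.\<close>

lemma biproduct_shear:
  assumes b: "biproduct_maps P A B i j p q" and f: "f \<in> Hom C A B"
  shows "\<exists>k. biproduct_maps P A B k j p (f \<cdot> p \<boxplus> q)"
proof -
  note b' = b[unfolded biproduct_maps_def Hom_def, simplified]
  note f' = f[unfolded Hom_def, simplified]
  obtain n where n: "n \<in> Arr C" "src n = A" "trg n = B" "n \<boxplus> f = Null C A B"
    using plus_inv[OF f] plus_comm[OF f] by (auto simp: Hom_def)
  have nf: "f \<boxplus> n = Null C A B" using n f' plus_comm_arr[of f n] by simp
  have obj: "A \<in> Obj C" "B \<in> Obj C" "P \<in> Obj C" using b' arr_objD[of i] arr_objD[of j] by auto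
  let ?k = "i \<boxplus> j \<cdot> n" and ?d = "f \<cdot> p \<boxplus> q"
  have pj: "p \<cdot> (j \<cdot> n) = Null C A A"
    using comp_reduce[of p j "Null C B A" n] b' n obj null_comp_arr[of n B A] by simp
  have qj: "q \<cdot> (j \<cdot> n) = n"
    using comp_reduce[of q j "Ident C B" n] b' n by (simp add: id_comp_arr)
  have pk: "p \<cdot> ?k = Ident C A"
    using b' n pj obj by (simp add: comp_plus_arr comp_arr plus_null_arr id_arr)
  have qk: "q \<cdot> ?k = n"
    using b' n qj by (simp add: comp_plus_arr comp_arr null_plus_arr)
  have karr: "?k \<in> Arr C" "src ?k = A" "trg ?k = P" using b' n by (simp_all add: comp_arr plus_arr)
  have darr: "?d \<in> Arr C" "src ?d = P" "trg ?d = B" using b' f' by (simp_all add: comp_arr plus_arr)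
  have "?d \<cdot> ?k = f \<cdot> (p \<cdot> ?k) \<boxplus> q \<cdot> ?k"
    using b' f' karr by (simp add: plus_comp_arr comp_arr assoc_arr)
  also have "\<dots> = Null C A B" unfolding pk qk using f' nf by (simp add: comp_id_arr)
  finally have dk: "?d \<cdot> ?k = Null C A B" .
  have dj: "?d \<cdot> j = Ident C B"
    using b' f' obj by (simp add: plus_comp_arr comp_arr assoc_arr comp_null_arr null_plus_arr id_arr)
  have "n \<cdot> p \<boxplus> ?d = n \<cdot> p \<boxplus> f \<cdot> p \<boxplus> q"
    using b' f' n by (intro plus_assoc_arr[symmetric]) (auto simp: comp_arr)
  also have "n \<cdot> p \<boxplus> f \<cdot> p = (n \<boxplus> f) \<cdot> p"
    using b' f' n(1-3) by (intro plus_comp_arr[symmetric]) (auto simp: comp_arr)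
  also have "(n \<boxplus> f) \<cdot> p \<boxplus> q = q"
    unfolding n(4) using b' obj by (simp add: null_comp_arr null_plus_arr)
  finally have ndq: "n \<cdot> p \<boxplus> ?d = q" .
  have "?k \<cdot> p \<boxplus> j \<cdot> ?d = i \<cdot> p \<boxplus> j \<cdot> (n \<cdot> p) \<boxplus> j \<cdot> ?d"
    using b' n by (simp add: plus_comp_arr comp_arr assoc_arr)
  also have "\<dots> = i \<cdot> p \<boxplus> (j \<cdot> (n \<cdot> p) \<boxplus> j \<cdot> ?d)"
    using b' n(1-3) darr by (intro plus_assoc_arr) (simp_all add: comp_arr)
  also have "j \<cdot> (n \<cdot> p) \<boxplus> j \<cdot> ?d = j \<cdot> (n \<cdot> p \<boxplus> ?d)"
    using b' n(1-3) darr by (intro comp_plus_arr[symmetric]) (simp_all add: comp_arr)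
  also have "i \<cdot> p \<boxplus> j \<cdot> (n \<cdot> p \<boxplus> ?d) = Ident C P" unfolding ndq using b' by simp
  finally have "?k \<cdot> p \<boxplus> j \<cdot> ?d = Ident C P" .
  then have "biproduct_maps P A B ?k j p ?d"
    using b' karr darr pk dk dj by (simp add: biproduct_maps_def Hom_def)
  then show ?thesis by blast
qed

lemma kernel_mono:
  assumes "is_kernel C k f" "g \<in> Hom C W (src k)" "h \<in> Hom C W (src k)" "k \<cdot> g = k \<cdot> h"
  shows "g = h"
proof -
  note k = assms(1)[unfolded is_kernel_def]
  have W: "W \<in> Obj C" using assms(2) arr_objD by (auto simp: Hom_def)
  have "f \<cdot> (k \<cdot> g) = Null C W (trg f)"
    using k assms(2) comp_reduce[of f k] by (auto simp: Hom_def arrow_simps)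
  moreover have "k \<cdot> g \<in> Hom C W (src f)" using k assms(2) by (auto simp: Hom_def comp_arr)
  ultimately have "\<exists>!h. h \<in> Hom C W (src k) \<and> k \<cdot> h = k \<cdot> g" using k W by blast
  then show ?thesis using assms by auto
qed

lemma cokernel_epi:
  assumes "is_cokernel C c f" "g \<in> Hom C (trg c) W" "h \<in> Hom C (trg c) W" "g \<cdot> c = h \<cdot> c"
  shows "g = h"
proof -
  note c = assms(1)[unfolded is_cokernel_def]
  have W: "W \<in> Obj C" using assms(2) arr_objD by (auto simp: Hom_def)
  have "g \<cdot> c \<cdot> f = Null C (src f) W"
    using c assms(2) by (auto simp: Hom_def arrow_simps)
  moreover have "g \<cdot> c \<in> Hom C (trg f) W" using c assms(2) by (auto simp: Hom_def comp_arr)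
  ultimately have "\<exists>!h. h \<in> Hom C (trg c) W \<and> h \<cdot> c = g \<cdot> c" using c W by blast
  then show ?thesis using assms by auto
qed

text \<open>If \<open>u\<close> is a retraction of \<open>f\<close>, the endomorphism \<open>1 - f \<cdot> u\<close> vanishes on the image of \<open>f\<close>. It
  factors through the cokernel of \<open>f\<close>, and the factor is the second injection.\<close>

lemma split_mono_biproduct:
  assumes c: "is_cokernel C c f" and u: "u \<in> Hom C (trg f) (src f)" "u \<cdot> f = Ident C (src f)"
  shows "\<exists>w. biproduct_maps (trg f) (src f) (trg c) f w u c"
proof -
  have c': "c \<in> Arr C" "f \<in> Arr C" "src c = trg f" "c \<cdot> f = Null C (src f) (trg c)"
    using c by (auto simp: is_cokernel_def)
  note u' = u[unfolded Hom_def, simplified]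
  let ?A = "src f" and ?B = "trg f" and ?D = "trg c"
  have obj: "?A \<in> Obj C" "?B \<in> Obj C" "?D \<in> Obj C" using c' arr_objD by auto
  \<comment> \<open>\<open>v\<close> is \<open>1 - f \<cdot> u\<close>; it kills \<open>f\<close> and so factors through the cokernel.\<close>
  obtain v where v: "v \<in> Arr C" "src v = ?B" "trg v = ?B" "f \<cdot> u \<boxplus> v = Ident C ?B"
  proof -
    obtain n where n: "n \<in> Arr C" "src n = ?B" "trg n = ?B" "f \<cdot> u \<boxplus> n = Null C ?B ?B"
      using plus_inv[of "f \<cdot> u" ?B ?B] c' u' by (auto simp: Hom_def comp_arr)
    have "f \<cdot> u \<boxplus> (n \<boxplus> Ident C ?B) = f \<cdot> u \<boxplus> n \<boxplus> Ident C ?B"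
      using n c' u' obj by (intro plus_assoc_arr[symmetric]) (auto simp: comp_arr id_arr)
    then have "f \<cdot> u \<boxplus> (n \<boxplus> Ident C ?B) = Ident C ?B" using n obj by (simp add: arrow_simps)
    then show ?thesis using n obj by (intro that[of "n \<boxplus> Ident C ?B"]) (auto simp: arrow_simps)
  qed
  have "f \<cdot> u \<cdot> f \<boxplus> v \<cdot> f = (f \<cdot> u \<boxplus> v) \<cdot> f"
    using c' u' v by (intro plus_comp_arr[symmetric]) (auto simp: comp_arr)
  also have "\<dots> = f" using c' v by (simp add: id_comp_arr)
  finally have "f \<boxplus> v \<cdot> f = f" using c' u' by (simp add: arrow_simps)
  then have vf: "v \<cdot> f = Null C ?A ?B"
    using plus_eq_left_imp_null[of "v \<cdot> f" f] v c' u' by (simp add: arrow_simps)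
  then obtain w where w: "w \<in> Arr C" "src w = ?D" "trg w = ?B" "w \<cdot> c = v"
  proof -
    have "v \<in> Hom C ?B ?B" using v by (simp add: Hom_def)
    then have "\<exists>!w. w \<in> Hom C ?D ?B \<and> w \<cdot> c = v" using c vf obj(2) unfolding is_cokernel_def by blast
    then show ?thesis using that by (auto simp: Hom_def)
  qed
  have "c \<cdot> (f \<cdot> u) \<boxplus> c \<cdot> v = c \<cdot> (f \<cdot> u \<boxplus> v)"
    using c' u' v by (intro comp_plus_arr[symmetric]) (auto simp: comp_arr)
  also have "\<dots> = c" using c' v by (simp add: comp_id_arr)
  finally have "c \<cdot> (f \<cdot> u) \<boxplus> c \<cdot> v = c" .
  moreover have "c \<cdot> (f \<cdot> u) = Null C ?B ?D"
    using comp_reduce[OF c'(4), of u] null_comp_arr[of u ?A ?D] c' u' obj by simp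
  moreover have "Null C ?B ?D \<boxplus> c \<cdot> v = c \<cdot> v"
    using c' v by (simp add: null_plus_arr comp_arr)
  ultimately have cv: "c \<cdot> v = c" by metis
  have cw: "c \<cdot> w = Ident C ?D"
    using c' w cv obj
    by - (rule cokernel_epi[OF c, of "c \<cdot> w" ?D "Ident C ?D"], simp_all add: Hom_def arrow_simps)
  have "u \<cdot> (f \<cdot> u) \<boxplus> u \<cdot> v = u \<cdot> (f \<cdot> u \<boxplus> v)"
    using c' u' v by (intro comp_plus_arr[symmetric]) (auto simp: comp_arr)
  also have "\<dots> = u" using u' v by (simp add: comp_id_arr)
  finally have "u \<boxplus> u \<cdot> v = u" using comp_reduce[OF u(2), of u] c' u' by (simp add: arrow_simps)
  then have uv: "u \<cdot> v = Null C ?B ?A"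
    using plus_eq_left_imp_null[of "u \<cdot> v" u] u' v by (simp add: arrow_simps)
  have uw: "u \<cdot> w = Null C ?D ?A"
    using c' w u' uv obj
    by - (rule cokernel_epi[OF c, of "u \<cdot> w" ?A "Null C ?D ?A"], simp_all add: Hom_def arrow_simps)
  show ?thesis
    using c' u' v w cw uw by (intro exI[of _ w]) (simp add: biproduct_maps_def Hom_def)
qed

end


section \<open>The morphism category\<close>

lemma mor_cat_simps:
  "Obj (mor_cat C) = Arr C"
  "Arrow f g (a, b) \<in> Arr (mor_cat C) \<longleftrightarrow> f \<in> Arr C \<and> g \<in> Arr C \<and>
    a \<in> Hom C (src f) (src g) \<and> b \<in> Hom C (trg f) (trg g) \<and> b \<cdot>\<^bsub>C\<^esub> f = g \<cdot>\<^bsub>C\<^esub> a"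
  "Arrow g h (a', b') \<cdot>\<^bsub>mor_cat C\<^esub> Arrow f g' (a, b) = Arrow f h (a' \<cdot>\<^bsub>C\<^esub> a, b' \<cdot>\<^bsub>C\<^esub> b)"
  "Arrow f g (a, b) \<boxplus>\<^bsub>mor_cat C\<^esub> Arrow f' g' (a', b') = Arrow f g (a \<boxplus>\<^bsub>C\<^esub> a', b \<boxplus>\<^bsub>C\<^esub> b')"
  "Ident (mor_cat C) f = Arrow f f (Ident C (src f), Ident C (trg f))"
  "Null (mor_cat C) f g = Arrow f g (Null C (src f) (src g), Null C (trg f) (trg g))"
  by (auto simp: mor_cat_def)

context preadditive_category
begin

text \<open>The factorisations of the two components through the kernels again form a commutative
  square, since the kernel of the second component is a monomorphism; dually for cokernels.\<close>

lemma mor_cat_kernel: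
  assumes k: "is_kernel C k1 d1" "is_kernel C k2 d2"
    and K: "Arrow z m (k1, k2) \<in> Arr (mor_cat C)" and D: "Arrow m f (d1, d2) \<in> Arr (mor_cat C)"
  shows "is_kernel (mor_cat C) (Arrow z m (k1, k2)) (Arrow m f (d1, d2))"
  unfolding is_kernel_def
proof (intro conjI ballI impI)
  note KD = K[unfolded mor_cat_simps Hom_def, simplified]
    D[unfolded mor_cat_simps Hom_def, simplified]
  show "Arrow m f (d1, d2) \<cdot>\<^bsub>mor_cat C\<^esub> Arrow z m (k1, k2) =
      Null (mor_cat C) (src (Arrow z m (k1, k2))) (trg (Arrow m f (d1, d2)))"
    using k KD by (simp add: mor_cat_simps is_kernel_def)
  fix w G assume w: "w \<in> Obj (mor_cat C)" and G: "G \<in> Hom (mor_cat C) w (src (Arrow m f (d1, d2)))"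
    and DG: "Arrow m f (d1, d2) \<cdot>\<^bsub>mor_cat C\<^esub> G = Null (mor_cat C) w (trg (Arrow m f (d1, d2)))"
  obtain a b where ab: "G = Arrow w m (a, b)" "w \<in> Arr C" "a \<in> Hom C (src w) (src m)"
      "b \<in> Hom C (trg w) (trg m)" "b \<cdot> w = m \<cdot> a"
    using G by (auto simp: mem_Hom_mor_cat)
  have d: "d1 \<cdot> a = Null C (src w) (src f)" "d2 \<cdot> b = Null C (trg w) (trg f)"
    using DG by (auto simp: ab(1) mor_cat_simps)
  have "\<exists>!h. h \<in> Hom C (src w) (src k1) \<and> k1 \<cdot> h = a"
    using k(1) d(1) ab KD arr_ends[of w] unfolding is_kernel_def by auto
  then obtain h1 where h1: "h1 \<in> Hom C (src w) (src z)" "k1 \<cdot> h1 = a" using KD by auto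
  have "\<exists>!h. h \<in> Hom C (trg w) (src k2) \<and> k2 \<cdot> h = b"
    using k(2) d(2) ab KD arr_ends[of w] unfolding is_kernel_def by auto
  then obtain h2 where h2: "h2 \<in> Hom C (trg w) (trg z)" "k2 \<cdot> h2 = b" using KD by auto
  have "k2 \<cdot> (h2 \<cdot> w) = b \<cdot> w"
    using h2 KD ab(2) comp_reduce[OF h2(2)] by (simp add: Hom_def)
  also have "\<dots> = m \<cdot> k1 \<cdot> h1"
    unfolding ab(5) h1(2)[symmetric] using h1(1) KD
    by (intro assoc_arr[symmetric]) (simp_all add: Hom_def)
  also have "m \<cdot> k1 = k2 \<cdot> z" using KD by simp
  also have "k2 \<cdot> z \<cdot> h1 = k2 \<cdot> (z \<cdot> h1)"
    using h1(1) KD by (intro assoc_arr) (simp_all add: Hom_def)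
  finally have "h2 \<cdot> w = z \<cdot> h1"
    using h1(1) h2(1) KD ab(2)
    by - (rule kernel_mono[OF k(2), of _ "src w"], simp_all add: Hom_def comp_arr)
  then have "Arrow w z (h1, h2) \<in> Hom (mor_cat C) w z"
    using h1 h2 KD ab by (simp add: mem_Hom_mor_cat)
  moreover have "H = Arrow w z (h1, h2)"
    if H': "H \<in> Hom (mor_cat C) w z" and e: "Arrow z m (k1, k2) \<cdot>\<^bsub>mor_cat C\<^esub> H = G" for H
  proof -
    obtain a' b' where H: "H = Arrow w z (a', b')" "a' \<in> Hom C (src w) (src z)"
        "b' \<in> Hom C (trg w) (trg z)"
      using H' by (auto simp: mem_Hom_mor_cat)
    have "k1 \<cdot> a' = k1 \<cdot> h1" "k2 \<cdot> b' = k2 \<cdot> h2"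
      using e h1 h2 by (auto simp: H(1) ab(1) mor_cat_simps)
    then show ?thesis
      using kernel_mono[OF k(1), of a' "src w" h1] kernel_mono[OF k(2), of b' "trg w" h2] H h1 h2 KD
      by simp
  qed
  moreover have "Arrow z m (k1, k2) \<cdot>\<^bsub>mor_cat C\<^esub> Arrow w z (h1, h2) = G"
    by (simp add: mor_cat_simps ab(1) h1(2) h2(2))
  ultimately show "\<exists>!h. h \<in> Hom (mor_cat C) w (src (Arrow z m (k1, k2))) \<and>
      Arrow z m (k1, k2) \<cdot>\<^bsub>mor_cat C\<^esub> h = G"
    unfolding arrow.sel by blast
qed (use K D in auto)

lemma mor_cat_cokernel:
  assumes c: "is_cokernel C c1 d1" "is_cokernel C c2 d2"
    and D: "Arrow f m (d1, d2) \<in> Arr (mor_cat C)" and K: "Arrow m z (c1, c2) \<in> Arr (mor_cat C)"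
  shows "is_cokernel (mor_cat C) (Arrow m z (c1, c2)) (Arrow f m (d1, d2))"
  unfolding is_cokernel_def
proof (intro conjI ballI impI)
  note KD = K[unfolded mor_cat_simps Hom_def, simplified]
    D[unfolded mor_cat_simps Hom_def, simplified]
  show "Arrow m z (c1, c2) \<cdot>\<^bsub>mor_cat C\<^esub> Arrow f m (d1, d2) =
      Null (mor_cat C) (src (Arrow f m (d1, d2))) (trg (Arrow m z (c1, c2)))"
    using c KD by (simp add: mor_cat_simps is_cokernel_def)
  fix w G assume w: "w \<in> Obj (mor_cat C)" and G: "G \<in> Hom (mor_cat C) (trg (Arrow f m (d1, d2))) w"
    and GD: "G \<cdot>\<^bsub>mor_cat C\<^esub> Arrow f m (d1, d2) = Null (mor_cat C) (src (Arrow f m (d1, d2))) w"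
  obtain a b where ab: "G = Arrow m w (a, b)" "w \<in> Arr C" "a \<in> Hom C (src m) (src w)"
      "b \<in> Hom C (trg m) (trg w)" "b \<cdot> m = w \<cdot> a"
    using G by (auto simp: mem_Hom_mor_cat)
  have d: "a \<cdot> d1 = Null C (src f) (src w)" "b \<cdot> d2 = Null C (trg f) (trg w)"
    using GD by (auto simp: ab(1) mor_cat_simps)
  have "\<exists>!h. h \<in> Hom C (trg c1) (src w) \<and> h \<cdot> c1 = a"
    using c(1) d(1) ab KD arr_ends[of w] unfolding is_cokernel_def by auto
  then obtain h1 where h1: "h1 \<in> Hom C (src z) (src w)" "h1 \<cdot> c1 = a" using KD by auto
  have "\<exists>!h. h \<in> Hom C (trg c2) (trg w) \<and> h \<cdot> c2 = b"
    using c(2) d(2) ab KD arr_ends[of w] unfolding is_cokernel_def by auto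
  then obtain h2 where h2: "h2 \<in> Hom C (trg z) (trg w)" "h2 \<cdot> c2 = b" using KD by auto
  have "h2 \<cdot> z \<cdot> c1 = h2 \<cdot> (c2 \<cdot> m)" using h2 KD by (auto simp: Hom_def assoc_arr)
  also have "\<dots> = b \<cdot> m"
    unfolding h2(2)[symmetric] using h2(1) KD
    by (intro assoc_arr[symmetric]) (simp_all add: Hom_def)
  also have "\<dots> = w \<cdot> h1 \<cdot> c1" using h1 KD ab by (auto simp: Hom_def assoc_arr)
  finally have "h2 \<cdot> z = w \<cdot> h1"
    using h1(1) h2(1) KD ab(2)
    by - (rule cokernel_epi[OF c(1), of _ "trg w"], simp_all add: Hom_def comp_arr)
  then have "Arrow z w (h1, h2) \<in> Hom (mor_cat C) z w"
    using h1 h2 KD ab by (simp add: mem_Hom_mor_cat)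
  moreover have "H = Arrow z w (h1, h2)"
    if H': "H \<in> Hom (mor_cat C) z w" and e: "H \<cdot>\<^bsub>mor_cat C\<^esub> Arrow m z (c1, c2) = G" for H
  proof -
    obtain a' b' where H: "H = Arrow z w (a', b')" "a' \<in> Hom C (src z) (src w)"
        "b' \<in> Hom C (trg z) (trg w)"
      using H' by (auto simp: mem_Hom_mor_cat)
    have "a' \<cdot> c1 = h1 \<cdot> c1" "b' \<cdot> c2 = h2 \<cdot> c2"
      using e h1 h2 by (auto simp: H(1) ab(1) mor_cat_simps)
    then show ?thesis
      using cokernel_epi[OF c(1), of a' "src w" h1] cokernel_epi[OF c(2), of b' "trg w" h2] H h1 h2 KD
      by simp
  qed
  moreover have "Arrow z w (h1, h2) \<cdot>\<^bsub>mor_cat C\<^esub> Arrow m z (c1, c2) = G"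
    by (simp add: mor_cat_simps ab(1) h1(2) h2(2))
  ultimately show "\<exists>!h. h \<in> Hom (mor_cat C) (trg (Arrow m z (c1, c2))) w \<and>
      h \<cdot>\<^bsub>mor_cat C\<^esub> Arrow m z (c1, c2) = G"
    unfolding arrow.sel by blast
qed (use K D in auto)

end


section \<open>The category of monomorphisms\<close>

text \<open>The cokernels of the split monomorphisms that occur below are biproduct complements, so
  closure under summands already puts them into \<open>\<X>\<close>.\<close>

locale summand_closed_subcat = preadditive_category C for C :: "('o, 'f) precat" (structure) +
  fixes \<X> :: "'o set"
  assumes subcat_obj: "\<X> \<subseteq> Obj C"
    and zero_ex: "\<exists>Z\<in>\<X>. is_zero C Z"
    and biproduct_ex: "\<lbrakk>A \<in> \<X>; B \<in> \<X>\<rbrakk> \<Longrightarrow> \<exists>S\<in>\<X>. is_biproduct C S A B"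
    and summand_mem: "\<lbrakk>is_biproduct C S A B; S \<in> \<X>\<rbrakk> \<Longrightarrow> A \<in> \<X> \<and> B \<in> \<X>"
begin

abbreviation \<S> where "\<S> \<equiv> S_cat C \<X>"
abbreviation cw where "cw \<equiv> E_cw C \<X>"

lemma S_objD:
  assumes "f \<in> S_obj C \<X>"
  shows "f \<in> Arr C" "src f \<in> \<X>" "trg f \<in> \<X>"
  using assms by (auto simp: S_obj_def is_mono_def)

lemma subcat_objD: "A \<in> \<X> \<Longrightarrow> A \<in> Obj C"
  using subcat_obj by blast

sublocale S: preadditive_category \<S>
  unfolding S_cat_def
  by (rule preadditive_category.full_subcat_preadditive[OF mor_cat_preadditive])
    (auto simp: mor_cat_simps S_objD)

lemma S_cat_simps:
  "Obj \<S> = S_obj C \<X>"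
  "u \<in> Arr \<S> \<longleftrightarrow> u \<in> Arr (mor_cat C) \<and> src u \<in> S_obj C \<X> \<and> trg u \<in> S_obj C \<X>"
  "Arrow g h (a', b') \<cdot>\<^bsub>\<S>\<^esub> Arrow f g' (a, b) = Arrow f h (a' \<cdot> a, b' \<cdot> b)"
  "Arrow f g (a, b) \<boxplus>\<^bsub>\<S>\<^esub> Arrow f' g' (a', b') = Arrow f g (a \<boxplus> a', b \<boxplus> b')"
  "Ident \<S> f = Arrow f f (Ident C (src f), Ident C (trg f))"
  "Null \<S> f g = Arrow f g (Null C (src f) (src g), Null C (trg f) (trg g))"
  by (auto simp: S_cat_def full_subcat_def mor_cat_def)

lemma S_hom:
  "Arrow f' g' (a, b) \<in> Hom \<S> f g \<longleftrightarrow> f' = f \<and> g' = g \<and> f \<in> S_obj C \<X> \<and> g \<in> S_obj C \<X> \<and>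
    a \<in> Hom C (src f) (src g) \<and> b \<in> Hom C (trg f) (trg g) \<and> b \<cdot> f = g \<cdot> a"
  by (auto simp: Hom_def[of \<S>] S_cat_simps mor_cat_simps S_objD)

lemma S_homE:
  assumes "u \<in> Hom \<S> f g"
  obtains a b where "u = Arrow f g (a, b)"
  using assms by (auto simp: Hom_def[of \<S>] S_cat_simps mor_cat_def)

lemma S_zero_iff:
  "is_zero \<S> f \<longleftrightarrow> f \<in> S_obj C \<X> \<and> is_zero C (src f) \<and> is_zero C (trg f)"
  by (auto simp: is_zero_def S_cat_simps dest: S_objD subcat_objD)

lemma S_biproduct_maps_iff:
  "S.biproduct_maps h f g (Arrow f h (i1, i2)) (Arrow g h (j1, j2)) (Arrow h f (p1, p2))
      (Arrow h g (q1, q2)) \<longleftrightarrow>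
    f \<in> S_obj C \<X> \<and> g \<in> S_obj C \<X> \<and> h \<in> S_obj C \<X> \<and>
    biproduct_maps (src h) (src f) (src g) i1 j1 p1 q1 \<and>
    biproduct_maps (trg h) (trg f) (trg g) i2 j2 p2 q2 \<and>
    i2 \<cdot> f = h \<cdot> i1 \<and> j2 \<cdot> g = h \<cdot> j1 \<and> p2 \<cdot> h = f \<cdot> p1 \<and> q2 \<cdot> h = g \<cdot> q1"
  by (auto simp: S.biproduct_maps_def biproduct_maps_def S_hom S_cat_simps)

lemma S_biproduct_mapsE:
  assumes "S.biproduct_maps h f g I J P Q"
  obtains i1 i2 j1 j2 p1 p2 q1 q2 where
    "f \<in> S_obj C \<X>" "g \<in> S_obj C \<X>" "h \<in> S_obj C \<X>"
    "biproduct_maps (src h) (src f) (src g) i1 j1 p1 q1"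
    "biproduct_maps (trg h) (trg f) (trg g) i2 j2 p2 q2"
    "i2 \<cdot> f = h \<cdot> i1" "j2 \<cdot> g = h \<cdot> j1" "p2 \<cdot> h = f \<cdot> p1" "q2 \<cdot> h = g \<cdot> q1"
proof -
  have "I \<in> Hom \<S> f h" "J \<in> Hom \<S> g h" "P \<in> Hom \<S> h f" "Q \<in> Hom \<S> h g"
    using assms by (auto simp: S.biproduct_maps_def)
  then obtain i1 i2 j1 j2 p1 p2 q1 q2 where
    "I = Arrow f h (i1, i2)" "J = Arrow g h (j1, j2)" "P = Arrow h f (p1, p2)" "Q = Arrow h g (q1, q2)"
    by (metis S_homE)
  then show ?thesis using assms that S_biproduct_maps_iff by auto
qed

lemma split_mono_in_S_obj:
  assumes b: "biproduct_maps P A D i j p q" and X: "P \<in> \<X>"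
  shows "i \<in> S_obj C \<X>"
proof -
  note b' = b[unfolded biproduct_maps_def Hom_def, simplified]
  have ex: "is_kernel C i q" "is_cokernel C q i"
    using biproduct_split_exact[OF b] by (auto simp: split_exact_def short_exact_def)
  have "A \<in> \<X>" "D \<in> \<X>" using summand_mem X b is_biproduct_iff_maps by blast+
  then show ?thesis
    using ex b' X kernel_mono[OF ex(1)] unfolding S_obj_def is_mono_def by auto
qed

lemma Ident_in_S_obj: "X \<in> \<X> \<Longrightarrow> Ident C X \<in> S_obj C \<X>"
  using zero_ex zero_biproduct_maps(1) split_mono_in_S_obj subcat_objD by blast

lemma Null_in_S_obj: "X \<in> \<X> \<Longrightarrow> is_zero C Z \<Longrightarrow> Null C Z X \<in> S_obj C \<X>"
  using zero_biproduct_maps(2) split_mono_in_S_obj subcat_objD by blast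

lemmas hom_simps = Hom_def arrow_simps subcat_objD

text \<open>The inclusion \<open>A \<rightarrow> A \<oplus> D\<close> is the direct sum of \<open>1\<^sub>A\<close> and \<open>0 \<rightarrow> D\<close>: in the first components
  this is \<open>A = A \<oplus> 0\<close>, in the second the given decomposition. It is used twice, for the
  projectivity of the inclusion and for the decomposition of a projective object.\<close>

lemma split_mono_S_biproduct:
  assumes b: "biproduct_maps P A D i j p q" and X: "P \<in> \<X>" and Z: "is_zero C Z"
  shows "is_biproduct \<S> i (Ident C A) (Null C Z D)"
proof -
  note b' = b[unfolded biproduct_maps_def Hom_def, simplified]
  have A: "A \<in> \<X>" "D \<in> \<X>" using summand_mem X b is_biproduct_iff_maps by blast+
  have Z': "Z \<in> Obj C" using Z by (simp add: is_zero_def)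
  have "S.biproduct_maps i (Ident C A) (Null C Z D)
      (Arrow (Ident C A) i (Ident C A, i)) (Arrow (Null C Z D) i (Null C Z A, j))
      (Arrow i (Ident C A) (Ident C A, p)) (Arrow i (Null C Z D) (Null C A Z, q))"
    unfolding S_biproduct_maps_iff
    using b b' A Z' zero_biproduct_maps(1)[OF Z, of A] split_mono_in_S_obj[OF b X]
      Ident_in_S_obj[OF A(1)] Null_in_S_obj[OF A(2) Z]
    by (simp add: arrow_simps subcat_objD)
  then show ?thesis by (auto simp: S.is_biproduct_iff_maps)
qed


subsection \<open>Indecomposability of \<open>1\<^sub>X\<close> and \<open>0 \<rightarrow> X\<close>\<close>

text \<open>A direct summand \<open>f\<close> of an identity is a retraction onto its target, because the projection
  to the target factors through \<open>f\<close>. Hence \<open>f\<close> vanishes as soon as its source does.\<close>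

lemma summand_of_Ident_zero:
  assumes "S.biproduct_maps (Ident C X) f g I J P Q" "X \<in> \<X>" "is_zero C (src f)"
  shows "is_zero \<S> f"
proof -
  obtain i1 i2 j1 j2 p1 p2 q1 q2 where m: "f \<in> S_obj C \<X>"
    "biproduct_maps (src (Ident C X)) (src f) (src g) i1 j1 p1 q1"
    "biproduct_maps (trg (Ident C X)) (trg f) (trg g) i2 j2 p2 q2"
    and sq: "p2 \<cdot> Ident C X = f \<cdot> p1"
    using assms(1) by (rule S_biproduct_mapsE)
  have X: "X \<in> Obj C" using assms subcat_objD by blast
  have p: "p1 \<in> Hom C X (src f)" "p2 \<in> Hom C X (trg f)" "i2 \<in> Hom C (trg f) X"
    "p2 \<cdot> i2 = Ident C (trg f)"
    using m X by (auto simp: biproduct_maps_def id_arr)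
  have "p2 = f \<cdot> p1" using sq p X by (simp add: Hom_def arrow_simps)
  then have "f \<cdot> (p1 \<cdot> i2) = Ident C (trg f)"
    using p S_objD(1)[OF m(1)] by (auto simp: Hom_def assoc_arr)
  then have "is_zero C (trg f)"
    using retract_of_zero[OF assms(3) Hom_self] comp_hom[OF p(3,1)] S_objD(1)[OF m(1)] by blast
  then show ?thesis using assms m by (simp add: S_zero_iff)
qed

lemma indecomposable_Ident_iff:
  assumes X: "X \<in> \<X>"
  shows "indecomposable \<S> (Ident C X) \<longleftrightarrow> indecomposable C X"
proof
  have X': "X \<in> Obj C" using X subcat_objD by blast
  assume L: "indecomposable \<S> (Ident C X)"
  show "indecomposable C X"
    unfolding indecomposable_def
  proof (intro conjI allI impI)
    show "\<not> is_zero C X"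
      using L Ident_in_S_obj[OF X] X' by (auto simp: indecomposable_def S_zero_iff id_arr)
    fix A B assume b: "is_biproduct C X A B"
    then have AB: "A \<in> \<X>" "B \<in> \<X>" using summand_mem X by blast+
    obtain i j p q where m: "biproduct_maps X A B i j p q"
      using b by (auto simp: is_biproduct_iff_maps)
    then have "S.biproduct_maps (Ident C X) (Ident C A) (Ident C B)
      (Arrow (Ident C A) (Ident C X) (i, i)) (Arrow (Ident C B) (Ident C X) (j, j))
      (Arrow (Ident C X) (Ident C A) (p, p)) (Arrow (Ident C X) (Ident C B) (q, q))"
      unfolding S_biproduct_maps_iff using AB X
      by (auto simp: arrow_simps subcat_objD Ident_in_S_obj biproduct_maps_def Hom_def)
    then have "is_zero \<S> (Ident C A) \<or> is_zero \<S> (Ident C B)"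
      using L S.is_biproduct_iff_maps unfolding indecomposable_def by blast
    then show "is_zero C A \<or> is_zero C B" using AB by (auto simp: S_zero_iff id_arr subcat_objD)
  qed (rule X')
next
  have X': "X \<in> Obj C" using X subcat_objD by blast
  assume R: "indecomposable C X"
  show "indecomposable \<S> (Ident C X)"
    unfolding indecomposable_def
  proof (intro conjI allI impI)
    show "Ident C X \<in> Obj \<S>" using X by (simp add: S_cat_simps Ident_in_S_obj)
    show "\<not> is_zero \<S> (Ident C X)" using R X' by (auto simp: S_zero_iff id_arr indecomposable_def)
    fix f g assume "is_biproduct \<S> (Ident C X) f g"
    then obtain I J P Q where b: "S.biproduct_maps (Ident C X) f g I J P Q"
      by (auto simp: S.is_biproduct_iff_maps)
    then have "is_biproduct C X (src f) (src g)"
      using X' by (elim S_biproduct_mapsE) (auto simp: is_biproduct_iff_maps id_arr)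
    then have "is_zero C (src f) \<or> is_zero C (src g)" using R by (simp add: indecomposable_def)
    then show "is_zero \<S> f \<or> is_zero \<S> g"
      using summand_of_Ident_zero[OF b X] summand_of_Ident_zero[OF S.biproduct_maps_swap[OF b] X]
      by blast
  qed
qed

lemma indecomposable_Null_iff:
  assumes X: "X \<in> \<X>" and Z: "is_zero C Z"
  shows "indecomposable \<S> (Null C Z X) \<longleftrightarrow> indecomposable C X"
proof
  have X': "X \<in> Obj C" "Z \<in> Obj C" using X Z subcat_objD by (auto simp: is_zero_def)
  assume L: "indecomposable \<S> (Null C Z X)"
  show "indecomposable C X"
    unfolding indecomposable_def
  proof (intro conjI allI impI)
    show "\<not> is_zero C X"
      using L Null_in_S_obj[OF X Z] X' Z by (auto simp: indecomposable_def S_zero_iff null_arr)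
    fix A B assume b: "is_biproduct C X A B"
    then have AB: "A \<in> \<X>" "B \<in> \<X>" using summand_mem X by blast+
    obtain i j p q where m: "biproduct_maps X A B i j p q"
      using b by (auto simp: is_biproduct_iff_maps)
    let ?z = "Null C Z Z"
    have "S.biproduct_maps (Null C Z X) (Null C Z A) (Null C Z B)
      (Arrow (Null C Z A) (Null C Z X) (?z, i)) (Arrow (Null C Z B) (Null C Z X) (?z, j))
      (Arrow (Null C Z X) (Null C Z A) (?z, p)) (Arrow (Null C Z X) (Null C Z B) (?z, q))"
      unfolding S_biproduct_maps_iff
      using AB X X' Z m zero_biproduct_maps(1)[OF Z X'(2)] m[unfolded biproduct_maps_def]
      by (auto simp: hom_simps Null_in_S_obj is_zero_def)
    then have "is_zero \<S> (Null C Z A) \<or> is_zero \<S> (Null C Z B)"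
      using L S.is_biproduct_iff_maps unfolding indecomposable_def by blast
    then show "is_zero C A \<or> is_zero C B"
      using AB X' by (auto simp: S_zero_iff null_arr subcat_objD)
  qed (rule X'(1))
next
  have X': "X \<in> Obj C" "Z \<in> Obj C" using X Z subcat_objD by (auto simp: is_zero_def)
  assume R: "indecomposable C X"
  show "indecomposable \<S> (Null C Z X)"
    unfolding indecomposable_def
  proof (intro conjI allI impI)
    show "Null C Z X \<in> Obj \<S>" using X Z by (simp add: S_cat_simps Null_in_S_obj)
    show "\<not> is_zero \<S> (Null C Z X)"
      using R X' by (auto simp: S_zero_iff null_arr indecomposable_def)
    fix f g assume "is_biproduct \<S> (Null C Z X) f g"
    then obtain i1 i2 j1 j2 p1 p2 q1 q2 where m: "f \<in> S_obj C \<X>" "g \<in> S_obj C \<X>"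
      "biproduct_maps Z (src f) (src g) i1 j1 p1 q1"
      "biproduct_maps X (trg f) (trg g) i2 j2 p2 q2"
      using X' by (auto simp: S.is_biproduct_iff_maps null_arr elim!: S_biproduct_mapsE)
    have "is_zero C (src f)" "is_zero C (src g)"
      using m(3) retract_of_zero[OF Z] unfolding biproduct_maps_def by blast+
    moreover have "is_zero C (trg f) \<or> is_zero C (trg g)"
      using R m(4) is_biproduct_iff_maps unfolding indecomposable_def by blast
    ultimately show "is_zero \<S> f \<or> is_zero \<S> g" using m by (auto simp: S_zero_iff)
  qed
qed

subsection \<open>Componentwise split conflations\<close>

lemma deflations_arr: "snd ` cw \<subseteq> Arr \<S>"
  by (auto simp: E_cw_def short_exact_def is_kernel_def S_cat_simps)

lemma deflationE:
  assumes "D \<in> snd ` cw"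
  obtains z y d1 d2 s1 s2 where "D = Arrow z y (d1, d2)" "z \<in> S_obj C \<X>" "y \<in> S_obj C \<X>"
    "d1 \<in> Hom C (src z) (src y)" "d2 \<in> Hom C (trg z) (trg y)" "d2 \<cdot> z = y \<cdot> d1"
    "s1 \<in> Hom C (src y) (src z)" "d1 \<cdot> s1 = Ident C (src y)"
    "s2 \<in> Hom C (trg y) (trg z)" "d2 \<cdot> s2 = Ident C (trg y)"
proof -
  obtain I where "(I, D) \<in> cw" using assms by auto
  then have sp: "split_exact C (fst (und I)) (fst (und D))" "split_exact C (snd (und I)) (snd (und D))"
    by (auto simp: E_cw_def)
  have D: "D \<in> Hom \<S> (src D) (trg D)" using deflations_arr assms by (auto simp: Hom_def)
  then obtain d1 d2 where D': "D = Arrow (src D) (trg D) (d1, d2)" by (rule S_homE)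
  have h: "src D \<in> S_obj C \<X>" "trg D \<in> S_obj C \<X>" "d1 \<in> Hom C (src (src D)) (src (trg D))"
    "d2 \<in> Hom C (trg (src D)) (trg (trg D))" "d2 \<cdot> src D = trg D \<cdot> d1"
    using D by (subst (asm) D', simp add: S_hom)+
  have "und D = (d1, d2)" using D' by (metis arrow.sel(3))
  then obtain s1 s2 where "s1 \<in> Hom C (src (trg D)) (src (src D))" "d1 \<cdot> s1 = Ident C (src (trg D))"
    "s2 \<in> Hom C (trg (trg D)) (trg (src D))" "d2 \<cdot> s2 = Ident C (trg (trg D))"
    using sp h by (auto simp: split_exact_def Hom_def)
  then show ?thesis using that[OF D' h] by blast
qed

text \<open>Once the first component \<open>a\<close> of a morphism out of \<open>1\<^sub>X\<close> is lifted along \<open>d1\<close>, the lift of the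
  second component is forced to be its composite with \<open>z\<close>, so a splitting of \<open>d1\<close> is enough.\<close>

lemma Ident_projective:
  assumes X: "X \<in> \<X>"
  shows "exact_projective \<S> cw (Ident C X)"
  unfolding exact_projective_def projective_wrt_def
proof (intro conjI ballI)
  show "Ident C X \<in> Obj \<S>" using X by (simp add: S_cat_simps Ident_in_S_obj)
  have X': "X \<in> Obj C" using X subcat_objD by blast
  fix D F assume D: "D \<in> snd ` cw" and F: "F \<in> Hom \<S> (Ident C X) (trg D)"
  obtain z y d1 d2 s1 s2 where d: "D = Arrow z y (d1, d2)" "z \<in> S_obj C \<X>" "y \<in> S_obj C \<X>"
    "d1 \<in> Hom C (src z) (src y)" "d2 \<in> Hom C (trg z) (trg y)" "d2 \<cdot> z = y \<cdot> d1"
    "s1 \<in> Hom C (src y) (src z)" "d1 \<cdot> s1 = Ident C (src y)"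
    using D by (rule deflationE)
  obtain a b where ab: "F = Arrow (Ident C X) y (a, b)" using F S_homE d(1) by (metis arrow.sel(2))
  have a: "a \<in> Hom C X (src y)" and b: "b \<in> Hom C X (trg y)" "b \<cdot> Ident C X = y \<cdot> a"
    using F X' by (auto simp: d(1) ab S_hom id_arr)
  note zy = S_objD(1)[OF d(2)] S_objD(1)[OF d(3)]
  have s: "s1 \<cdot> a \<in> Hom C X (src z)" using comp_hom[OF a d(7)] .
  have d1: "d1 \<cdot> (s1 \<cdot> a) = a"
    using comp_assoc[OF a d(7,4)] d(8) id_comp[OF a] by simp
  have "d2 \<cdot> (z \<cdot> (s1 \<cdot> a)) = y \<cdot> d1 \<cdot> (s1 \<cdot> a)"
    using comp_assoc[OF s Hom_self[OF zy(1)] d(5)] d(6) by simp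
  also have "\<dots> = b" using comp_assoc[OF s d(4) Hom_self[OF zy(2)]] d1 b(2) comp_id[OF b(1)] by simp
  finally have d2: "d2 \<cdot> (z \<cdot> (s1 \<cdot> a)) = b" .
  have zs: "z \<cdot> (s1 \<cdot> a) \<in> Hom C X (trg z)" using comp_hom[OF s Hom_self[OF zy(1)]] .
  show "\<exists>G\<in>Hom \<S> (Ident C X) (src D). D \<cdot>\<^bsub>\<S>\<^esub> G = F"
    using s zs d1 d2 d(2) Ident_in_S_obj[OF X] comp_id[OF zs]
    by (intro bexI[of _ "Arrow (Ident C X) z (s1 \<cdot> a, z \<cdot> (s1 \<cdot> a))"])
      (simp_all add: d(1) ab S_cat_simps S_hom id_arr X')
qed

text \<open>The first component of a morphism out of \<open>0 \<rightarrow> X\<close> vanishes, and any lift of the second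
  component makes the square commute.\<close>

lemma Null_projective:
  assumes X: "X \<in> \<X>" and Z: "is_zero C Z"
  shows "exact_projective \<S> cw (Null C Z X)"
  unfolding exact_projective_def projective_wrt_def
proof (intro conjI ballI)
  show "Null C Z X \<in> Obj \<S>" using X Z by (simp add: S_cat_simps Null_in_S_obj)
  have X': "X \<in> Obj C" "Z \<in> Obj C" using X Z subcat_objD by (auto simp: is_zero_def)
  fix D F assume D: "D \<in> snd ` cw" and F: "F \<in> Hom \<S> (Null C Z X) (trg D)"
  obtain z y d1 d2 s1 s2 where d: "D = Arrow z y (d1, d2)" "z \<in> S_obj C \<X>" "y \<in> S_obj C \<X>"
    "d1 \<in> Hom C (src z) (src y)" "d2 \<in> Hom C (trg z) (trg y)"
    and s2: "s2 \<in> Hom C (trg y) (trg z)" "d2 \<cdot> s2 = Ident C (trg y)"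
    using D by (rule deflationE)
  obtain a b where ab: "F = Arrow (Null C Z X) y (a, b)" using F S_homE d(1) by (metis arrow.sel(2))
  have a: "a \<in> Hom C Z (src y)" "b \<in> Hom C X (trg y)"
    using F X' by (auto simp: d(1) ab S_hom null_arr)
  note zy = S_objD(1)[OF d(2)] S_objD(1)[OF d(3)]
  have s: "s2 \<cdot> b \<in> Hom C X (trg z)" using comp_hom[OF a(2) s2(1)] .
  have d2: "d2 \<cdot> (s2 \<cdot> b) = b" using comp_assoc[OF a(2) s2(1) d(5)] s2(2) id_comp[OF a(2)] by simp
  have "d1 \<cdot> Null C Z (src z) = Null C Z (src y)"
    using d(4) X' by (auto simp: Hom_def comp_null_arr)
  also have "\<dots> = a" using hom_from_zero[OF Z, of a] a(1) by (simp add: Hom_def)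
  finally have d1: "d1 \<cdot> Null C Z (src z) = a" .
  have "s2 \<cdot> b \<cdot> Null C Z X = z \<cdot> Null C Z (src z)"
    using s zy X' by (simp add: Hom_def comp_null_arr)
  then show "\<exists>G\<in>Hom \<S> (Null C Z X) (src D). D \<cdot>\<^bsub>\<S>\<^esub> G = F"
    using s d1 d2 d(2) Null_in_S_obj[OF X Z] X' zy null_hom[of Z "src z"]
    by (intro bexI[of _ "Arrow (Null C Z X) z (Null C Z (src z), s2 \<cdot> b)"])
      (simp_all add: d(1) ab S_cat_simps S_hom null_arr arr_objD)
qed

lemma split_mono_projective:
  assumes b: "biproduct_maps P A D i j p q" and X: "P \<in> \<X>"
  shows "exact_projective \<S> cw i"
proof -
  obtain Z where Z: "is_zero C Z" using zero_ex by blast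
  have A: "A \<in> \<X>" "D \<in> \<X>" using summand_mem X b is_biproduct_iff_maps by blast+
  then show ?thesis
    using S.projective_wrt_biproduct[OF split_mono_S_biproduct[OF b X Z] deflations_arr]
      Ident_projective Null_projective[OF _ Z] unfolding exact_projective_def by blast
qed

text \<open>Every object \<open>f : A \<rightarrow> B\<close> is the target of a deflation from the split monomorphism
  \<open>A \<rightarrow> A \<oplus> B\<close>: it is the identity on \<open>A\<close> and \<open>(f, 1)\<close> on \<open>A \<oplus> B\<close>. Shearing the biproduct
  along \<open>f\<close> exhibits \<open>(f, 1)\<close> as a split epimorphism with kernel \<open>A\<close>.\<close>

lemma standard_conflation:
  assumes f: "f \<in> S_obj C \<X>" and b: "biproduct_maps P (src f) (trg f) i j p q" and P: "P \<in> \<X>"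
  obtains I where "(I, Arrow i f (Ident C (src f), f \<cdot> p \<boxplus> q)) \<in> cw"
proof -
  let ?A = "src f" and ?B = "trg f" and ?d = "f \<cdot> p \<boxplus> q"
  note f' = S_objD[OF f]
  have A: "?A \<in> Obj C" "?B \<in> Obj C" using f' arr_objD by auto
  obtain Z where Z: "is_zero C Z" using zero_ex by blast
  then have Z': "Z \<in> Obj C" by (simp add: is_zero_def)
  obtain k where k: "biproduct_maps P ?A ?B k j p ?d"
    using biproduct_shear[OF b Hom_self] f' by blast
  note b' = b[unfolded biproduct_maps_def Hom_def, simplified]
  note k' = k[unfolded biproduct_maps_def Hom_def, simplified]
  let ?n = "Null C Z ?A" and ?e = "Ident C ?A"
  have split: "split_exact C ?n ?e" "split_exact C k ?d"
    using biproduct_split_exact zero_biproduct_maps(2)[OF Z A(1)] k by blast+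
  have "?d \<cdot> i = f \<cdot> ?e"
    using b' f' A by (simp add: arrow_simps)
  moreover have "k \<cdot> ?n = i \<cdot> ?n" using k' b' Z' by (simp add: comp_null_arr)
  ultimately have arr: "Arrow ?n i (?n, k) \<in> Arr (mor_cat C)" "Arrow i f (?e, ?d) \<in> Arr (mor_cat C)"
    using b' k' f' A Z' by (simp_all add: mor_cat_simps Hom_def id_arr null_arr)
  have "short_exact (mor_cat C) (Arrow ?n i (?n, k)) (Arrow i f (?e, ?d))"
    using mor_cat_kernel[OF _ _ arr] mor_cat_cokernel[OF _ _ arr] split
    by (simp add: short_exact_def split_exact_def)
  then have "(Arrow ?n i (?n, k), Arrow i f (?e, ?d)) \<in> cw"
    using f split split_mono_in_S_obj[OF b P] Null_in_S_obj[OF f'(2) Z] by (simp add: E_cw_def)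
  then show ?thesis using that by blast
qed

theorem enough_projectives_cw: "enough_projectives \<S> cw"
  unfolding enough_projectives_def
proof
  fix f assume "f \<in> Obj \<S>"
  then have f: "f \<in> S_obj C \<X>" by (simp add: S_cat_simps)
  then obtain P i j p q where P: "P \<in> \<X>" "biproduct_maps P (src f) (trg f) i j p q"
    using biproduct_ex S_objD by (meson is_biproduct_iff_maps)
  obtain I where "(I, Arrow i f (Ident C (src f), f \<cdot> p \<boxplus> q)) \<in> cw"
    using f P(2,1) by (rule standard_conflation)
  then show "\<exists>(i, p)\<in>cw. trg p = f \<and> exact_projective \<S> cw (src p)"
    using split_mono_projective[OF P(2,1)]
    by (intro bexI[of _ "(I, Arrow i f (Ident C (src f), f \<cdot> p \<boxplus> q))"]) simp_all
qed

text \<open>A section of the deflation above is the identity on \<open>A\<close>, hence agrees on the image of \<open>f\<close>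
  with the inclusion of \<open>A\<close>. Its composite with the projection to \<open>A\<close> is then a retraction of
  \<open>f\<close>.\<close>

lemma projective_imp_split_mono:
  assumes proj: "exact_projective \<S> cw f"
  shows "\<exists>u\<in>Hom C (trg f) (src f). u \<cdot> f = Ident C (src f)"
proof -
  have f: "f \<in> S_obj C \<X>"
    using proj by (simp add: exact_projective_def projective_wrt_def S_cat_simps)
  note f' = S_objD[OF f]
  obtain P i j p q where P: "P \<in> \<X>" "biproduct_maps P (src f) (trg f) i j p q"
    using biproduct_ex f' by (meson is_biproduct_iff_maps)
  let ?D = "Arrow i f (Ident C (src f), f \<cdot> p \<boxplus> q)"
  note b = P(2)[unfolded biproduct_maps_def Hom_def, simplified]
  obtain I where "(I, ?D) \<in> cw"
    using f P(2,1) by (rule standard_conflation)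
  then have "?D \<in> snd ` cw" by force
  moreover have "Ident \<S> f \<in> Hom \<S> f (trg ?D)" using S.id_hom f by (simp add: S_cat_simps)
  ultimately obtain G where G: "G \<in> Hom \<S> f i" "?D \<cdot>\<^bsub>\<S>\<^esub> G = Ident \<S> f"
    using proj unfolding exact_projective_def projective_wrt_def by force
  obtain s1 s2 where s: "G = Arrow f i (s1, s2)" using G(1) by (rule S_homE)
  have h: "s1 \<in> Hom C (src f) (src f)" "s2 \<in> Hom C (trg f) P" "s2 \<cdot> f = i \<cdot> s1"
    using G(1) b by (auto simp: s S_hom)
  have "s1 = Ident C (src f)"
    using G(2) id_comp[OF h(1)] by (simp add: s S_cat_simps)
  then have "s2 \<cdot> f = i" using h(3) b by (simp add: comp_id_arr)
  then have "p \<cdot> s2 \<cdot> f = Ident C (src f)"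
    using h(2) b f'(1) by (simp add: Hom_def assoc_arr)
  moreover have "p \<cdot> s2 \<in> Hom C (trg f) (src f)" using h(2) b by (simp add: Hom_def comp_arr)
  ultimately show ?thesis by blast
qed

theorem indecomposable_projective_iff:
  assumes f: "f \<in> S_obj C \<X>"
  shows "indecomposable \<S> f \<and> exact_projective \<S> cw f \<longleftrightarrow>
    (\<exists>X\<in>\<X>. indecomposable C X \<and> isomorphic \<S> f (Ident C X)) \<or>
    (\<exists>X\<in>\<X>. indecomposable C X \<and> (\<exists>Z. is_zero C Z \<and> isomorphic \<S> f (Null C Z X)))"
    (is "?L \<longleftrightarrow> ?R")
proof
  assume L: ?L
  note f' = S_objD[OF f]
  obtain u where u: "u \<in> Hom C (trg f) (src f)" "u \<cdot> f = Ident C (src f)"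
    using projective_imp_split_mono L by blast
  obtain c where c: "is_cokernel C c f" using f by (auto simp: S_obj_def)
  obtain w where "biproduct_maps (trg f) (src f) (trg c) f w u c"
    using split_mono_biproduct[OF c u] by blast
  moreover obtain Z where Z: "is_zero C Z" using zero_ex by blast
  ultimately have b: "is_biproduct \<S> f (Ident C (src f)) (Null C Z (trg c))"
    and D: "trg c \<in> \<X>"
    using split_mono_S_biproduct f'(3) summand_mem is_biproduct_iff_maps by blast+
  have "isomorphic \<S> f (Ident C (src f)) \<or> isomorphic \<S> f (Null C Z (trg c))"
    using S.is_biproduct_with_zero[OF b] L b unfolding indecomposable_def by blast
  then show ?R
  proof
    assume "isomorphic \<S> f (Ident C (src f))"
    then show ?R
      using S.indecomposable_isomorphic L f'(2) indecomposable_Ident_iff by blast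
  next
    assume "isomorphic \<S> f (Null C Z (trg c))"
    then show ?R
      using S.indecomposable_isomorphic L D Z indecomposable_Null_iff by blast
  qed
next
  have transfer: ?L if "isomorphic \<S> f g" "indecomposable \<S> g" "exact_projective \<S> cw g" for g
    using that S.isomorphic_sym S.indecomposable_isomorphic
      S.projective_wrt_isomorphic[OF _ deflations_arr] unfolding exact_projective_def by blast
  assume ?R
  then show ?L
    using transfer indecomposable_Ident_iff indecomposable_Null_iff Ident_projective Null_projective
    by blast
qed

end


section \<open>Direct sums of modules\<close>

definition direct_sum :: "('a, 'b) module \<Rightarrow> ('a, 'c) module \<Rightarrow> ('a, 'b \<times> 'c) module" where
  "direct_sum M N = \<lparr>carrier = carrier M \<times> carrier N, mult = undefined, one = undefined,
    zero = (\<zero>\<^bsub>M\<^esub>, \<zero>\<^bsub>N\<^esub>),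
    add = (\<lambda>(x, y) (x', y'). (x \<oplus>\<^bsub>M\<^esub> x', y \<oplus>\<^bsub>N\<^esub> y')),
    smult = (\<lambda>r (x, y). (r \<odot>\<^bsub>M\<^esub> x, r \<odot>\<^bsub>N\<^esub> y))\<rparr>"

lemma direct_sum_simps [simp]:
  "carrier (direct_sum M N) = carrier M \<times> carrier N"
  "\<zero>\<^bsub>direct_sum M N\<^esub> = (\<zero>\<^bsub>M\<^esub>, \<zero>\<^bsub>N\<^esub>)"
  "(x, y) \<oplus>\<^bsub>direct_sum M N\<^esub> (x', y') = (x \<oplus>\<^bsub>M\<^esub> x', y \<oplus>\<^bsub>N\<^esub> y')"
  "r \<odot>\<^bsub>direct_sum M N\<^esub> (x, y) = (r \<odot>\<^bsub>M\<^esub> x, r \<odot>\<^bsub>N\<^esub> y)"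
  by (simp_all add: direct_sum_def)

lemma act_zero:
  assumes "right_module R M" "r \<in> carrier R"
  shows "r \<odot>\<^bsub>M\<^esub> \<zero>\<^bsub>M\<^esub> = \<zero>\<^bsub>M\<^esub>"
proof -
  interpret right_module R M by fact
  show ?thesis
    using act_r_distr[of r "\<zero>\<^bsub>M\<^esub>" "\<zero>\<^bsub>M\<^esub>"] act_closed[of r "\<zero>\<^bsub>M\<^esub>"] assms by simp
qed

lemma right_module_direct_sum:
  assumes "right_module R M" "right_module R N"
  shows "right_module R (direct_sum M N)"
proof -
  interpret M: right_module R M by fact
  interpret N: right_module R N by fact
  have "abelian_group (direct_sum M N)"
  proof (rule abelian_groupI)
    fix u assume "u \<in> carrier (direct_sum M N)"
    then show "\<exists>v\<in>carrier (direct_sum M N). v \<oplus>\<^bsub>direct_sum M N\<^esub> u = \<zero>\<^bsub>direct_sum M N\<^esub>"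
      by (intro bexI[of _ "(\<ominus>\<^bsub>M\<^esub> fst u, \<ominus>\<^bsub>N\<^esub> snd u)"]) (auto simp: M.M.l_neg N.M.l_neg)
  qed (auto simp: M.M.a_ac N.M.a_ac)
  then show ?thesis
    by (intro right_module.intro M.R.ring_axioms right_module_axioms.intro)
      (auto simp: M.act_closed N.act_closed M.act_l_distr N.act_l_distr M.act_r_distr N.act_r_distr
        M.act_assoc N.act_assoc M.act_one N.act_one)
qed

text \<open>Zero is left out of the generators so that the generators of the two summands of a direct
  sum are disjoint.\<close>

lemma fg_nonzero_generators:
  assumes "fg_right_module R M"
  obtains S where "finite S" "S \<subseteq> carrier M" "\<zero>\<^bsub>M\<^esub> \<notin> S"
    "\<And>x. x \<in> carrier M \<Longrightarrow> \<exists>c\<in>S \<rightarrow> carrier R. x = (\<Oplus>\<^bsub>M\<^esub>s\<in>S. c s \<odot>\<^bsub>M\<^esub> s)"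
proof -
  have rM: "right_module R M" using assms by (simp add: fg_right_module_def)
  interpret right_module R M by (rule rM)
  obtain S where S: "finite S" "S \<subseteq> carrier M"
    "\<And>x. x \<in> carrier M \<Longrightarrow> \<exists>c\<in>S \<rightarrow> carrier R. x = (\<Oplus>\<^bsub>M\<^esub>s\<in>S. c s \<odot>\<^bsub>M\<^esub> s)"
    using assms by (auto simp: fg_right_module_def)
  have *: "(\<Oplus>\<^bsub>M\<^esub>s\<in>S - {\<zero>\<^bsub>M\<^esub>}. c s \<odot>\<^bsub>M\<^esub> s) = (\<Oplus>\<^bsub>M\<^esub>s\<in>S. c s \<odot>\<^bsub>M\<^esub> s)" if "c \<in> S \<rightarrow> carrier R" for c
    using that S(1,2) act_zero[OF rM]
    by (intro M.add.finprod_mono_neutral_cong_left) (auto intro!: act_closed)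
  have "\<exists>c\<in>S - {\<zero>\<^bsub>M\<^esub>} \<rightarrow> carrier R. x = (\<Oplus>\<^bsub>M\<^esub>s\<in>S - {\<zero>\<^bsub>M\<^esub>}. c s \<odot>\<^bsub>M\<^esub> s)" if x: "x \<in> carrier M" for x
  proof -
    obtain c where "c \<in> S \<rightarrow> carrier R" "x = (\<Oplus>\<^bsub>M\<^esub>s\<in>S. c s \<odot>\<^bsub>M\<^esub> s)"
      using S(3)[OF x] by blast
    then show ?thesis using * by (intro bexI[of _ c]) auto
  qed
  then show ?thesis using S by (intro that[of "S - {\<zero>\<^bsub>M\<^esub>}"]) auto
qed

text \<open>The coefficient of \<open>l s\<close> is that of \<open>s\<close>, which is well defined because \<open>l\<close> is injective on the
  generators.\<close>

lemma linear_combination_image: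
  assumes rM: "right_module R M" and rN: "right_module R N" and l: "linear_map R M N l"
    and S: "finite S" "S \<subseteq> carrier M" "inj_on l S" and c: "c \<in> S \<rightarrow> carrier R"
  shows "\<exists>d\<in>l ` S \<rightarrow> carrier R. l (\<Oplus>\<^bsub>M\<^esub>s\<in>S. c s \<odot>\<^bsub>M\<^esub> s) = (\<Oplus>\<^bsub>N\<^esub>t\<in>l ` S. d t \<odot>\<^bsub>N\<^esub> t)"
proof -
  interpret M: right_module R M by (rule rM)
  interpret N: right_module R N by (rule rN)
  let ?d = "\<lambda>t. c (inv_into S l t)"
  have cl: "l s \<in> carrier N" "c s \<in> carrier R" "?d (l s) = c s" if "s \<in> S" for s
    using that S c l by (auto simp: linear_map_def)
  have "l (\<Oplus>\<^bsub>M\<^esub>s\<in>S. c s \<odot>\<^bsub>M\<^esub> s) = (\<Oplus>\<^bsub>N\<^esub>s\<in>S. l (c s \<odot>\<^bsub>M\<^esub> s))"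
    by (rule linear_map_finsum[OF rM rN l S(1)]) (use cl S(2) in \<open>auto intro!: M.act_closed\<close>)
  also have "\<dots> = (\<Oplus>\<^bsub>N\<^esub>s\<in>S. ?d (l s) \<odot>\<^bsub>N\<^esub> l s)"
    by (rule N.M.finsum_cong')
      (use cl S(2) l in \<open>auto simp: linear_map_def intro!: N.act_closed\<close>)
  also have "\<dots> = (\<Oplus>\<^bsub>N\<^esub>t\<in>l ` S. ?d t \<odot>\<^bsub>N\<^esub> t)"
    by (rule N.M.add.finprod_reindex[symmetric]) (use cl S in \<open>auto intro!: N.act_closed\<close>)
  finally show ?thesis using cl by (intro bexI[of _ ?d]) auto
qed

lemma fg_direct_sum:
  assumes fg: "fg_right_module R M" "fg_right_module R N"
  shows "fg_right_module R (direct_sum M N)"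
proof -
  have rM: "right_module R M" and rN: "right_module R N"
    using fg by (simp_all add: fg_right_module_def)
  interpret M: right_module R M by (rule rM)
  interpret N: right_module R N by (rule rN)
  let ?P = "direct_sum M N"
  have rP: "right_module R ?P" by (rule right_module_direct_sum[OF rM rN])
  interpret P: right_module R ?P by (rule rP)
  let ?l = "\<lambda>x. (x, \<zero>\<^bsub>N\<^esub>)" and ?r = "\<lambda>y. (\<zero>\<^bsub>M\<^esub>, y)"
  have lin: "linear_map R M ?P ?l" "linear_map R N ?P ?r"
    by (auto simp: linear_map_def act_zero[OF rM] act_zero[OF rN])
  obtain S where S: "finite S" "S \<subseteq> carrier M" "\<zero>\<^bsub>M\<^esub> \<notin> S"
    "\<And>x. x \<in> carrier M \<Longrightarrow> \<exists>c\<in>S \<rightarrow> carrier R. x = (\<Oplus>\<^bsub>M\<^esub>s\<in>S. c s \<odot>\<^bsub>M\<^esub> s)"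
    using fg_nonzero_generators[OF fg(1)] by blast
  obtain T where T: "finite T" "T \<subseteq> carrier N" "\<zero>\<^bsub>N\<^esub> \<notin> T"
    "\<And>x. x \<in> carrier N \<Longrightarrow> \<exists>c\<in>T \<rightarrow> carrier R. x = (\<Oplus>\<^bsub>N\<^esub>s\<in>T. c s \<odot>\<^bsub>N\<^esub> s)"
    using fg_nonzero_generators[OF fg(2)] by blast
  have "\<exists>c\<in>?l ` S \<union> ?r ` T \<rightarrow> carrier R. u = (\<Oplus>\<^bsub>?P\<^esub>s\<in>?l ` S \<union> ?r ` T. c s \<odot>\<^bsub>?P\<^esub> s)"
    if u: "u \<in> carrier ?P" for u
  proof -
    obtain x y where xy: "u = (x, y)" "x \<in> carrier M" "y \<in> carrier N" using u by auto
    obtain d where d: "d \<in> ?l ` S \<rightarrow> carrier R" "?l x = (\<Oplus>\<^bsub>?P\<^esub>t\<in>?l ` S. d t \<odot>\<^bsub>?P\<^esub> t)"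
    proof -
      obtain c where c: "c \<in> S \<rightarrow> carrier R" "x = (\<Oplus>\<^bsub>M\<^esub>s\<in>S. c s \<odot>\<^bsub>M\<^esub> s)"
        using S(4)[OF xy(2)] by blast
      have "inj_on ?l S" by (simp add: inj_on_def)
      then show thesis
        using linear_combination_image[OF rM rP lin(1) S(1,2) _ c(1)] c(2) that by auto
    qed
    obtain e where e: "e \<in> ?r ` T \<rightarrow> carrier R" "?r y = (\<Oplus>\<^bsub>?P\<^esub>t\<in>?r ` T. e t \<odot>\<^bsub>?P\<^esub> t)"
    proof -
      obtain c where c: "c \<in> T \<rightarrow> carrier R" "y = (\<Oplus>\<^bsub>N\<^esub>s\<in>T. c s \<odot>\<^bsub>N\<^esub> s)"
        using T(4)[OF xy(3)] by blast
      have "inj_on ?r T" by (simp add: inj_on_def)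
      then show thesis
        using linear_combination_image[OF rN rP lin(2) T(1,2) _ c(1)] c(2) that by auto
    qed
    let ?c = "\<lambda>t. if t \<in> ?l ` S then d t else e t"
    have disj: "?l ` S \<inter> ?r ` T = {}" using S(3) by auto
    have cS: "d t \<odot>\<^bsub>?P\<^esub> t \<in> carrier ?P" if "t \<in> ?l ` S" for t
      using that d(1) S(2) by (intro P.act_closed) auto
    have cT: "e t \<odot>\<^bsub>?P\<^esub> t \<in> carrier ?P" if "t \<in> ?r ` T" for t
      using that e(1) T(2) by (intro P.act_closed) auto
    have "(\<Oplus>\<^bsub>?P\<^esub>t\<in>?l ` S \<union> ?r ` T. ?c t \<odot>\<^bsub>?P\<^esub> t) =
        (\<Oplus>\<^bsub>?P\<^esub>t\<in>?l ` S. ?c t \<odot>\<^bsub>?P\<^esub> t) \<oplus>\<^bsub>?P\<^esub> (\<Oplus>\<^bsub>?P\<^esub>t\<in>?r ` T. ?c t \<odot>\<^bsub>?P\<^esub> t)"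
    proof (rule P.M.finsum_Un_disjoint)
      show "(\<lambda>t. ?c t \<odot>\<^bsub>?P\<^esub> t) \<in> ?r ` T \<rightarrow> carrier ?P"
      proof
        fix t assume t: "t \<in> ?r ` T"
        then have "t \<notin> ?l ` S" using disj by blast
        then show "?c t \<odot>\<^bsub>?P\<^esub> t \<in> carrier ?P" using cT[OF t] by (simp only: if_False)
      qed
    qed (use S(1) T(1) disj cS in \<open>simp_all add: Pi_iff del: direct_sum_simps\<close>)
    also have "(\<Oplus>\<^bsub>?P\<^esub>t\<in>?l ` S. ?c t \<odot>\<^bsub>?P\<^esub> t) = ?l x"
      unfolding d(2) by (rule P.M.finsum_cong') (use cS in simp_all)
    also have "(\<Oplus>\<^bsub>?P\<^esub>t\<in>?r ` T. ?c t \<odot>\<^bsub>?P\<^esub> t) = ?r y"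
      unfolding e(2)
    proof (rule P.M.finsum_cong')
      fix t assume t: "t \<in> ?r ` T"
      then have "t \<notin> ?l ` S" using disj by blast
      then show "?c t \<odot>\<^bsub>?P\<^esub> t = e t \<odot>\<^bsub>?P\<^esub> t" by (simp only: if_False)
    qed (use cT in auto)
    also have "?l x \<oplus>\<^bsub>?P\<^esub> ?r y = u" using xy by simp
    finally have "u = (\<Oplus>\<^bsub>?P\<^esub>t\<in>?l ` S \<union> ?r ` T. ?c t \<odot>\<^bsub>?P\<^esub> t)" by (rule sym)
    moreover have "?c \<in> ?l ` S \<union> ?r ` T \<rightarrow> carrier R"
    proof (rule Pi_I)
      fix t assume "t \<in> ?l ` S \<union> ?r ` T"
      then show "?c t \<in> carrier R"
        using funcset_mem[OF d(1), of t] funcset_mem[OF e(1), of t] by (metis Un_iff)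
    qed
    ultimately show ?thesis by (rule bexI[of _ ?c])
  qed
  then show ?thesis
    unfolding fg_right_module_def using rP S(1,2) T(1,2)
    by (intro conjI exI[of _ "?l ` S \<union> ?r ` T"]) auto
qed

lemma mod_cat_simps:
  "Obj (mod_cat R) = {M. fg_right_module R M}"
  "Arrow N L g \<cdot>\<^bsub>mod_cat R\<^esub> Arrow M N' f = Arrow M L (compose (carrier M) g f)"
  "Ident (mod_cat R) M = Arrow M M (\<lambda>x\<in>carrier M. x)"
  "Arrow M N f \<boxplus>\<^bsub>mod_cat R\<^esub> Arrow M' N' g = Arrow M N (\<lambda>x\<in>carrier M. f x \<oplus>\<^bsub>N\<^esub> g x)"
  "Null (mod_cat R) M N = Arrow M N (\<lambda>x\<in>carrier M. \<zero>\<^bsub>N\<^esub>)"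
  by (simp_all add: mod_cat_def)

text \<open>The direct sum lives on a type of pairs; the biproduct is a copy of it among the objects of
  the category.\<close>

lemma mod_cat_biproduct_ex:
  fixes R :: "('a, 'x) ring_scheme" and A B :: "('a, 'a list) module"
  assumes fg: "fg_right_module R A" "fg_right_module R B"
  shows "\<exists>S. is_biproduct (mod_cat R) S A B"
proof -
  have rM: "right_module R A" "right_module R B"
    using fg by (simp_all add: fg_right_module_def)
  interpret A: right_module R A by (rule rM)
  interpret B: right_module R B by (rule rM)
  let ?P = "direct_sum A B"
  obtain N :: "('a, 'a list) module" and h where N: "fg_right_module R N" and h: "linear_map R ?P N h"
    "bij_betw h (carrier ?P) (carrier N)"
    using mod_cat_adequate[OF fg_direct_sum[OF fg]] by (auto simp: mod_cat_simps)
  interpret N: right_module R N using N by (simp add: fg_right_module_def)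
  define g where "g = inv_into (carrier ?P) h"
  have hcl: "h (x, y) \<in> carrier N" if "x \<in> carrier A" "y \<in> carrier B" for x y
    using h(1) that by (auto simp: linear_map_def)
  have hadd: "h (x, y) \<oplus>\<^bsub>N\<^esub> h (x', y') = h (x \<oplus>\<^bsub>A\<^esub> x', y \<oplus>\<^bsub>B\<^esub> y')"
    if "x \<in> carrier A" "y \<in> carrier B" "x' \<in> carrier A" "y' \<in> carrier B" for x y x' y'
    using h(1) that by (auto simp: linear_map_def)
  have hact: "r \<odot>\<^bsub>N\<^esub> h (x, y) = h (r \<odot>\<^bsub>A\<^esub> x, r \<odot>\<^bsub>B\<^esub> y)"
    if "r \<in> carrier R" "x \<in> carrier A" "y \<in> carrier B" for x y r
    using h(1) that by (auto simp: linear_map_def)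
  have gh: "g (h (x, y)) = (x, y)" if "x \<in> carrier A" "y \<in> carrier B" for x y
    using h(2) that by (auto simp: g_def bij_betw_def inv_into_f_f)
  have surj: "\<exists>x\<in>carrier A. \<exists>y\<in>carrier B. u = h (x, y)" if "u \<in> carrier N" for u
  proof -
    have "u \<in> h ` (carrier A \<times> carrier B)" using h(2) that by (simp add: bij_betw_def)
    then show ?thesis by blast
  qed
  let ?i = "\<lambda>x\<in>carrier A. h (x, \<zero>\<^bsub>B\<^esub>)" and ?j = "\<lambda>y\<in>carrier B. h (\<zero>\<^bsub>A\<^esub>, y)"
  let ?p = "\<lambda>u\<in>carrier N. fst (g u)" and ?q = "\<lambda>u\<in>carrier N. snd (g u)"
  have lin: "linear_map R A N ?i" "linear_map R B N ?j"
    by (auto simp: linear_map_def hcl hadd hact A.act_closed B.act_closed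
        act_zero[OF rM(1)] act_zero[OF rM(2)])
  have lin': "linear_map R N A ?p" "linear_map R N B ?q"
    by (auto simp: linear_map_def N.act_closed A.act_closed B.act_closed hadd hact gh dest!: surj)
  have sum: "h (fst (g u), \<zero>\<^bsub>B\<^esub>) \<oplus>\<^bsub>N\<^esub> h (\<zero>\<^bsub>A\<^esub>, snd (g u)) = u"
    and gcl: "fst (g u) \<in> carrier A" "snd (g u) \<in> carrier B" if "u \<in> carrier N" for u
    using surj[OF that] by (auto simp: gh hadd)
  show ?thesis
    unfolding is_biproduct_def
  proof (intro exI[of _ N] conjI bexI)
    show "Arrow A N ?i \<in> Hom (mod_cat R) A N" "Arrow B N ?j \<in> Hom (mod_cat R) B N"
      "Arrow N A ?p \<in> Hom (mod_cat R) N A" "Arrow N B ?q \<in> Hom (mod_cat R) N B"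
      using fg N lin lin' by (auto simp: mem_Hom_mod_cat)
    show "Arrow A N ?i \<cdot>\<^bsub>mod_cat R\<^esub> Arrow N A ?p \<boxplus>\<^bsub>mod_cat R\<^esub> Arrow B N ?j \<cdot>\<^bsub>mod_cat R\<^esub> Arrow N B ?q =
        Ident (mod_cat R) N"
      using sum gcl by (auto simp: mod_cat_simps compose_def intro!: restrict_ext)
  qed (use fg N in \<open>auto simp: mod_cat_simps compose_def hcl gh intro!: restrict_ext\<close>)
qed

lemma mod_cat_zero_ex:
  fixes R :: "('a, 'x) ring_scheme"
  assumes "ring R"
  shows "\<exists>Z. is_zero (mod_cat R) Z"
proof -
  interpret R: ring R by fact
  define Z :: "('a, 'a list) module" where
    "Z = \<lparr>carrier = {[]}, mult = undefined, one = undefined, zero = [],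
      add = (\<lambda>_ _. []), smult = (\<lambda>_ _. [])\<rparr>"
  have Z: "carrier Z = {[]}" "\<zero>\<^bsub>Z\<^esub> = []" "x \<oplus>\<^bsub>Z\<^esub> y = []" "r \<odot>\<^bsub>Z\<^esub> x = []" for x y r
    by (simp_all add: Z_def)
  have ag: "abelian_group Z" by (rule abelian_groupI) (auto simp: Z)
  have "right_module R Z"
    by (intro right_module.intro ag assms right_module_axioms.intro) (auto simp: Z)
  moreover have "(\<Oplus>\<^bsub>Z\<^esub>s\<in>{}. undefined s \<odot>\<^bsub>Z\<^esub> s) = []"
    using abelian_monoid.finsum_empty[of Z] ag by (simp add: Z abelian_group_def)
  ultimately have "fg_right_module R Z"
    unfolding fg_right_module_def by (intro conjI exI[of _ "{}"]) (auto simp: Z)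
  then show ?thesis by (auto simp: is_zero_def mod_cat_simps Z intro!: restrict_ext)
qed

section \<open>Resolving subcategories of module categories\<close>

text \<open>A zero object is projective, so a resolving class contains it.\<close>

lemma resolving_summand_closed:
  assumes "ring R" "resolving (mod_cat R) \<X>"
  shows "summand_closed_subcat (mod_cat R) \<X>"
proof -
  interpret preadditive_category "mod_cat R" by (rule mod_cat_preadditive)
  have res: "\<X> \<subseteq> Obj (mod_cat R)" "{P. projective_wrt (mod_cat R) {p. is_epi (mod_cat R) p} P} \<subseteq> \<X>"
    "\<And>S A B. is_biproduct (mod_cat R) S A B \<Longrightarrow> A \<in> \<X> \<Longrightarrow> B \<in> \<X> \<Longrightarrow> S \<in> \<X>"
    "\<And>S A B. is_biproduct (mod_cat R) S A B \<Longrightarrow> S \<in> \<X> \<Longrightarrow> A \<in> \<X> \<and> B \<in> \<X>"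
    using assms(2) unfolding resolving_def iso_closed_subcat_def by blast+
  show ?thesis
  proof (unfold_locales)
    obtain Z where Z: "is_zero (mod_cat R) Z" using mod_cat_zero_ex[OF assms(1)] by blast
    have "projective_wrt (mod_cat R) {p. is_epi (mod_cat R) p} Z"
      by (rule zero_projective[OF Z]) (auto simp: is_epi_def)
    then show "\<exists>Z\<in>\<X>. is_zero (mod_cat R) Z" using Z res(2) by blast
    show "\<exists>S\<in>\<X>. is_biproduct (mod_cat R) S A B" if AB: "A \<in> \<X>" "B \<in> \<X>" for A B
    proof -
      have "fg_right_module R A" "fg_right_module R B" using AB res(1) by (auto simp: mod_cat_simps)
      then obtain S where S: "is_biproduct (mod_cat R) S A B" using mod_cat_biproduct_ex by blast
      then show ?thesis using res(3)[OF S AB] by blast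
    qed
    show "\<X> \<subseteq> Obj (mod_cat R)" by (rule res(1))
    show "A \<in> \<X> \<and> B \<in> \<X>" if "is_biproduct (mod_cat R) S A B" "S \<in> \<X>" for S A B
      using that by (rule res(4))
  qed
qed

theorem proposition3p5:
  fixes K :: "('k, 'x) ring_scheme" and \<Lambda> :: "('a, 'y) ring_scheme" and \<phi> :: "'k \<Rightarrow> 'a"
    and \<X> :: "('a, 'a list) module set"
  assumes "artin_algebra K \<Lambda> \<phi>"
    and "resolving (mod_cat \<Lambda>) \<X>"
    and "contravariantly_finite (mod_cat \<Lambda>) \<X>"
  shows "(\<forall>F\<in>Obj (S_cat (mod_cat \<Lambda>) \<X>).
      indecomposable (S_cat (mod_cat \<Lambda>) \<X>) F \<and>
      exact_projective (S_cat (mod_cat \<Lambda>) \<X>) (E_cw (mod_cat \<Lambda>) \<X>) F \<longleftrightarrow>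
      (\<exists>X\<in>\<X>. indecomposable (mod_cat \<Lambda>) X \<and>
        isomorphic (S_cat (mod_cat \<Lambda>) \<X>) F (Ident (mod_cat \<Lambda>) X)) \<or>
      (\<exists>X\<in>\<X>. indecomposable (mod_cat \<Lambda>) X \<and>
        (\<exists>Z. is_zero (mod_cat \<Lambda>) Z \<and>
          isomorphic (S_cat (mod_cat \<Lambda>) \<X>) F (Null (mod_cat \<Lambda>) Z X))))
    \<and> enough_projectives (S_cat (mod_cat \<Lambda>) \<X>) (E_cw (mod_cat \<Lambda>) \<X>)"
proof -
  interpret summand_closed_subcat "mod_cat \<Lambda>" \<X>
    using assms by (intro resolving_summand_closed) (simp_all add: artin_algebra_def)
  show ?thesis
    unfolding S_cat_simps(1) by (intro conjI ballI indecomposable_projective_iff enough_projectives_cw)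
qed

end
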